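(* Let $m$ and $d$ be positive integers with $d\le m$, and write $m=t(d+1)+\alpha$ with integers $t\ge 0$ and $0\le\alpha\le d$. Then the independence complex of the $d$-regular bipartite graph $G_m^d$ satisfies $$\mathrm{Ind}(G_m^d)\simeq\begin{cases}\bigvee_{d\text{ copies}} S^{2t-1} & \text{if }\alpha=0,\\ S^{2t} & \text{otherwise,}\end{cases}$$ where $\simeq$ denotes homotopy equivalence and $\bigvee_{d\text{ copies}} S^{2t-1}$ is the wedge sum of $d$ spheres of dimension $2t-1$.
   Context: For positive integers $d\le m$, $G_m^d$ is the graph with vertex set $A\sqcup B$, $A=\{a_1,\dots,a_m\}$, $B=\{b_1,\dots,b_m\}$, whose only edges join elements of $A$ to elements of $B$: the neighborhood of $a_i$ is $N(a_i)=\{b_i,b_{i+1},\dots,b_{i+d-1}\}$, with indices taken modulo $m$ in $\{1,\dots,m\}$. The independence complex $\mathrm{Ind}(G)$ of a graph $G$ is the simplicial complex whose simplices are the independent sets of vertices of $G$ (sets with no two adjacent vertices). *)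

theory Defs
  imports "HOL-Analysis.Analysis"
begin

section \<open>The graph\<close>

datatype vert = A nat | B nat

(* the representative of k modulo m in {1..m} (for k \<ge> 1) *)
definition cyc_index :: "nat \<Rightarrow> nat \<Rightarrow> nat" where
  "cyc_index m k = (k - 1) mod m + 1"

definition G_nbhd :: "nat \<Rightarrow> nat \<Rightarrow> nat \<Rightarrow> vert set" where
  "G_nbhd m d i = {B (cyc_index m (i + k)) | k. k < d}"

definition G_verts :: "nat \<Rightarrow> vert set" where
  "G_verts m = A ` {1..m} \<union> B ` {1..m}"

definition G_edges :: "nat \<Rightarrow> nat \<Rightarrow> vert set set" where
  "G_edges m d = {{A i, v} | i v. i \<in> {1..m} \<and> v \<in> G_nbhd m d i}"

lemma cyc_index_in_range: "0 < m \<Longrightarrow> cyc_index m k \<in> {1..m}"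
  by (simp add: cyc_index_def Suc_leI)

lemma cyc_index_id: "k \<in> {1..m} \<Longrightarrow> cyc_index m k = k"
  by (auto simp: cyc_index_def)

lemma G_edges_subset:
  assumes "e \<in> G_edges m d"
  shows "e \<subseteq> G_verts m" "card e = 2"
proof -
  obtain i k where "e = {A i, B (cyc_index m (i + k))}" "i \<in> {1..m}"
    using assms by (auto simp: G_edges_def G_nbhd_def)
  moreover from this have "cyc_index m (i + k) \<in> {1..m}"
    by (intro cyc_index_in_range) auto
  ultimately show "e \<subseteq> G_verts m" "card e = 2"
    by (auto simp: G_verts_def)
qed

section \<open>Independence complexes and geometric realization\<close>

definition independence_complex :: "'v set \<Rightarrow> 'v set set \<Rightarrow> 'v set set" where
  "independence_complex V E = {S. finite S \<and> S \<subseteq> V \<and> (\<forall>u\<in>S. \<forall>v\<in>S. {u, v} \<notin> E)}"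

(* Points are given by barycentric coordinates, extended by 0 to the whole vertex type.
   For a finite complex this subspace topology coincides with the weak topology;
   for infinite complexes it need not, so this is meant for finite complexes only.
   The empty simplex carries no point. *)
definition geometric_realization :: "'v set set \<Rightarrow> ('v \<Rightarrow> real) topology" where
  "geometric_realization K =
     subtopology (powertop_real UNIV)
       {x. (\<forall>v. 0 \<le> x v) \<and> finite {v. x v \<noteq> 0} \<and> {v. x v \<noteq> 0} \<in> K
           \<and> (\<Sum>v | x v \<noteq> 0. x v) = 1}"

lemma independence_complex_subset:
  "\<lbrakk>S \<in> independence_complex V E; T \<subseteq> S\<rbrakk> \<Longrightarrow> T \<in> independence_complex V E"
  by (auto simp: independence_complex_def intro: finite_subset)

section \<open>Quotient spaces and wedge sums\<close>

definition quotient_space :: "'a topology \<Rightarrow> ('a \<times> 'a) set \<Rightarrow> 'a set topology" where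
  "quotient_space X R =
     topology (\<lambda>U. U \<subseteq> topspace X // R \<and> openin X {x \<in> topspace X. R `` {x} \<in> U})"

lemma istopology_quotient_space:
  "istopology (\<lambda>U. U \<subseteq> topspace X // R \<and> openin X {x \<in> topspace X. R `` {x} \<in> U})"
proof -
  have Int: "{x \<in> topspace X. R `` {x} \<in> S \<inter> T} =
      {x \<in> topspace X. R `` {x} \<in> S} \<inter> {x \<in> topspace X. R `` {x} \<in> T}" for S T
    by auto
  have Un: "{x \<in> topspace X. R `` {x} \<in> \<Union>\<K>} =
      (\<Union>U\<in>\<K>. {x \<in> topspace X. R `` {x} \<in> U})" for \<K>
    by auto
  show ?thesis
    unfolding istopology_def Int Un by blast
qed

lemma openin_quotient_space:
  "openin (quotient_space X R) U \<longleftrightarrow>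
     U \<subseteq> topspace X // R \<and> openin X {x \<in> topspace X. R `` {x} \<in> U}"
  by (simp add: quotient_space_def topology_inverse'[OF istopology_quotient_space])

lemma topspace_quotient_space: "topspace (quotient_space X R) = topspace X // R"
proof (rule antisym)
  show "topspace (quotient_space X R) \<subseteq> topspace X // R"
    using openin_quotient_space by blast
  have "{x \<in> topspace X. R `` {x} \<in> topspace X // R} = topspace X"
    by (auto simp: quotient_def)
  then have "openin (quotient_space X R) (topspace X // R)"
    by (simp add: openin_quotient_space)
  then show "topspace X // R \<subseteq> topspace (quotient_space X R)"
    by (rule openin_subset)
qed

lemma quotient_map_quotient_space:
  "quotient_map X (quotient_space X R) (\<lambda>x. R `` {x})"
  by (auto simp: quotient_map_def topspace_quotient_space openin_quotient_space quotient_def)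

definition wedge_rel ::
  "'i set \<Rightarrow> ('i \<Rightarrow> 'a topology) \<Rightarrow> ('i \<Rightarrow> 'a) \<Rightarrow> (('i \<times> 'a) \<times> ('i \<times> 'a)) set" where
  "wedge_rel I X p =
     Id_on (topspace (sum_topology X I)) \<union> {((i, p i), (j, p j)) | i j. i \<in> I \<and> j \<in> I}"

definition wedge_sum ::
  "'i set \<Rightarrow> ('i \<Rightarrow> 'a topology) \<Rightarrow> ('i \<Rightarrow> 'a) \<Rightarrow> ('i \<times> 'a) set topology" where
  "wedge_sum I X p = quotient_space (sum_topology X I) (wedge_rel I X p)"

lemma equiv_wedge_rel:
  assumes "\<And>i. i \<in> I \<Longrightarrow> p i \<in> topspace (X i)"
  shows "equiv (topspace (sum_topology X I)) (wedge_rel I X p)"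
  using assms
  by (intro equivI) (auto simp: wedge_rel_def refl_on_def sym_def trans_def)

definition nsphere_basepoint :: "nat \<Rightarrow> real" where
  "nsphere_basepoint = (\<lambda>i. if i = 0 then 1 else 0)"

lemma nsphere_basepoint_in: "nsphere_basepoint \<in> topspace (nsphere n)"
  by (simp add: nsphere nsphere_basepoint_def if_distrib [where f = "\<lambda>x. x ^ 2"] cong: if_cong)

definition wedge_of_spheres :: "nat \<Rightarrow> nat \<Rightarrow> (nat \<times> (nat \<Rightarrow> real)) set topology" where
  "wedge_of_spheres k n = wedge_sum {1..k} (\<lambda>_. nsphere n) (\<lambda>_. nsphere_basepoint)"

end

theory Submission
  imports Defs
begin

text \<open>
Write \<open>a\<^sub>x\<close> and \<open>b\<^sub>y\<close> for the vertices, with indices from \<open>0\<close> and modulo \<open>m\<close>, so that \<open>a\<^sub>x\<close> is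
adjacent to \<open>b\<^sub>x, \<dots>, b\<^bsub>x+d-1\<^esub>\<close>. The neighbours of \<open>b\<^bsub>d-1\<^esub>\<close> are exactly \<open>a\<^sub>0, \<dots>, a\<^bsub>d-1\<^esub>\<close>: without
these \<open>d\<close> vertices the complex is a cone with apex \<open>b\<^bsub>d-1\<^esub>\<close>. The theorem follows by putting them
back one at a time, which attaches a cone over a link each time.

When \<open>a\<^sub>0, \<dots>, a\<^bsub>r-1\<^esub>\<close> are absent, the link of \<open>a\<^sub>r\<close> is the independence complex of the graph on the
\<open>a\<^sub>x\<close> with \<open>r < x < m\<close> and the \<open>b\<^sub>y\<close> with \<open>r + d \<le> y < m + r\<close>. Removing the neighbours of \<open>a\<^sub>r\<close> has cut the
circle open, and \<open>a\<^sub>x\<close> is adjacent to \<open>b\<^sub>y\<close> just when \<open>x \<le> y < x + d\<close>. In such a staircase graph the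
first \<open>b\<close> dominates other \<open>b\<close>s, after which the first \<open>a\<close> dominates other \<open>a\<close>s, and what splits off is
one isolated edge; two such steps advance all indices by \<open>d + 1\<close>. If the two sides are used up
simultaneously after \<open>k\<close> steps, the complex has become that of \<open>k\<close> disjoint edges, which is the
boundary of the \<open>k\<close>-dimensional cross-polytope, a sphere of dimension \<open>k - 1\<close>. If one side is used up
first, a vertex of the other side is isolated and the link is contractible.

For \<open>\<alpha> > 0\<close> the count gives a contractible link for each \<open>r < d\<close> other than \<open>r = \<alpha> - 1\<close>, and \<open>k = 2t\<close> for
that one: up to homotopy a single cone over a sphere of dimension \<open>2t - 1\<close> is attached to a
contractible space, which gives the sphere of dimension \<open>2t\<close>. For \<open>\<alpha> = 0\<close> all \<open>d\<close> links are spheres with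
\<open>k = 2t - 1\<close>. There one first makes \<open>a\<^sub>0, \<dots>, a\<^bsub>d-1\<^esub>\<close> pairwise adjacent; the links of the edges
\<open>{a\<^sub>r, a\<^sub>s}\<close> are contractible by the same count, so the homotopy type is unchanged. Then the \<open>d\<close> cones
are attached to the contractible base independently of one another, which gives a wedge.

All homotopy equivalences up to this point are composed of one kind of deformation retraction,
\<open>cone_step_homotopy_equivalent\<close>, and its inverse; everything else about them is combinatorics of
finite complexes. Lemma \<open>bouquet_of_cones\<close> turns the attached cones into cross-polytopes with
one common vertex, and only at the end are these identified with round spheres.
\<close>

section \<open>Collapsing cones in a simplicial complex\<close>

definition subset_closed :: "'v set set \<Rightarrow> bool" where
  "subset_closed K \<longleftrightarrow> (\<forall>\<sigma>\<in>K. \<forall>\<tau>. \<tau> \<subseteq> \<sigma> \<longrightarrow> \<tau> \<in> K)"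

definition delete_star :: "'v set set \<Rightarrow> 'v set \<Rightarrow> 'v set set" where
  "delete_star K \<sigma> = {\<tau> \<in> K. \<not> \<sigma> \<subseteq> \<tau>}"

text \<open>
The faces around \<open>\<sigma>\<close> form a cone with apex \<open>w\<close>, so that they can be pushed away from \<open>\<sigma>\<close>.
For a singleton \<open>\<sigma>\<close> this deletes a dominated vertex. In an independence complex, a two-element \<open>\<sigma>\<close>
corresponds to adding an edge to the graph.
\<close>

definition cone_step :: "'v set set \<Rightarrow> 'v set set \<Rightarrow> bool" where
  "cone_step K K' \<longleftrightarrow> (\<exists>\<sigma> w. finite \<sigma> \<and> \<sigma> \<noteq> {} \<and> w \<notin> \<sigma> \<and>
     (\<forall>\<tau>\<in>K. \<sigma> \<subseteq> \<tau> \<longrightarrow> insert w \<tau> \<in> K) \<and> K' = delete_star K \<sigma>)"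

abbreviation collapses :: "'v set set \<Rightarrow> 'v set set \<Rightarrow> bool" where
  "collapses \<equiv> cone_step\<^sup>*\<^sup>*"

lemma topspace_geometric_realization:
  "topspace (geometric_realization K) =
     {x. (\<forall>v. 0 \<le> x v) \<and> finite {v. x v \<noteq> 0} \<and> {v. x v \<noteq> 0} \<in> K
           \<and> (\<Sum>v | x v \<noteq> 0. x v) = 1}"
  by (simp add: geometric_realization_def)

lemma continuous_map_realization_coordinate:
  "continuous_map (geometric_realization K) euclideanreal (\<lambda>x. x v)"
  unfolding geometric_realization_def
  by (blast intro: continuous_map_from_subtopology continuous_map_product_projection)

lemma continuous_map_into_realization:
  "continuous_map X (geometric_realization K) f \<longleftrightarrow>
     (\<forall>v. continuous_map X euclideanreal (\<lambda>x. f x v)) \<and>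
     f \<in> topspace X \<rightarrow> topspace (geometric_realization K)"
  unfolding topspace_geometric_realization
  by (simp add: geometric_realization_def continuous_map_in_subtopology
      continuous_map_componentwise_UNIV)

lemma continuous_map_Min:
  fixes f :: "'i \<Rightarrow> 'a \<Rightarrow> real"
  assumes "finite I" "I \<noteq> {}" "\<And>i. i \<in> I \<Longrightarrow> continuous_map X euclideanreal (f i)"
  shows "continuous_map X euclideanreal (\<lambda>x. Min ((\<lambda>i. f i x) ` I))"
  using assms
proof (induction I rule: finite_ne_induct)
  case (insert i I)
  have "continuous_map X euclideanreal (\<lambda>x. min (f i x) (Min ((\<lambda>i. f i x) ` I)))"
    using insert by (intro continuous_map_real_min) auto
  then show ?case
    using insert.hyps by simp
qed simp

text \<open>
Let \<open>c\<close> be the least barycentric coordinate over the vertices of \<open>\<sigma>\<close>. Moving the amount \<open>c\<close> from every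
vertex of \<open>\<sigma>\<close> to \<open>w\<close> along a straight line is continuous and fixes all points whose support does
not contain \<open>\<sigma>\<close>, because there \<open>c = 0\<close>. A support \<open>\<tau>\<close> that contains \<open>\<sigma>\<close> stays inside
\<open>insert w \<tau>\<close>, which is a face, and in the end has lost a vertex of \<open>\<sigma>\<close>.
\<close>

lemma cone_step_homotopy_equivalent:
  fixes K K' :: "'v set set"
  assumes K: "subset_closed K" and "cone_step K K'"
  shows "geometric_realization K homotopy_equivalent_space geometric_realization K'"
proof -
  obtain \<sigma> w where \<sigma>: "finite \<sigma>" "\<sigma> \<noteq> {}" "w \<notin> \<sigma>" and K': "K' = delete_star K \<sigma>"
    and cone: "\<And>\<tau>. \<tau> \<in> K \<Longrightarrow> \<sigma> \<subseteq> \<tau> \<Longrightarrow> insert w \<tau> \<in> K"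
    using assms(2) unfolding cone_step_def by blast
  let ?X = "geometric_realization K" and ?Y = "geometric_realization K'"
  define c where "c x = Min (x ` \<sigma>)" for x :: "'v \<Rightarrow> real"
  define H where "H s x = (\<lambda>v. x v - (if v \<in> \<sigma> then s * c x else 0)
     + (if v = w then s * (card \<sigma> * c x) else 0))" for s x
  have c_le: "c x \<le> x v" if "v \<in> \<sigma>" for x v
    using \<sigma> that by (simp add: c_def)
  have c_attained: "\<exists>v\<in>\<sigma>. x v = c x" for x
  proof -
    have "c x \<in> x ` \<sigma>" unfolding c_def using \<sigma> by (intro Min_in) auto
    then show ?thesis by auto
  qed
  have c0: "c x = 0" if x: "x \<in> topspace ?X" "\<not> \<sigma> \<subseteq> {v. x v \<noteq> 0}" for x
  proof -
    obtain v where "v \<in> \<sigma>" "x v = 0" using x(2) by auto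
    then have "c x \<le> 0" using c_le[of v x] by simp
    moreover obtain u where "u \<in> \<sigma>" "x u = c x" using c_attained by blast
    ultimately show ?thesis
      using x(1) by (metis (mono_tags, lifting) mem_Collect_eq order_antisym topspace_geometric_realization)
  qed
  have H_in: "H s x \<in> topspace ?X" "s = 1 \<Longrightarrow> H s x \<in> topspace ?Y"
    if x: "x \<in> topspace ?X" and s: "0 \<le> s" "s \<le> 1" for s x
  proof -
    have x': "\<And>v. 0 \<le> x v" "finite {v. x v \<noteq> 0}" "{v. x v \<noteq> 0} \<in> K"
      "(\<Sum>v | x v \<noteq> 0. x v) = 1"
      using x by (auto simp: topspace_geometric_realization)
    have "H s x \<in> topspace ?X \<and> (s = 1 \<longrightarrow> H s x \<in> topspace ?Y)"
    proof (cases "\<sigma> \<subseteq> {v. x v \<noteq> 0}")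
      case False
      then have Hx: "H s x = x" using c0[OF x] by (simp add: H_def fun_eq_iff)
      show ?thesis unfolding Hx using x False
        by (auto simp: K' delete_star_def topspace_geometric_realization)
    next
      case True
      let ?S = "insert w {v. x v \<noteq> 0}"
      have SK: "?S \<in> K" using cone[OF x'(3) True] .
      have finS: "finite ?S" using x' by simp
      have cpos: "0 \<le> c x" using c_attained x'(1) by metis
      have nonneg: "0 \<le> H s x v" for v
      proof -
        have "s * c x \<le> x v" if "v \<in> \<sigma>"
          using c_le[OF that, of x] cpos s mult_left_le_one_le[of "c x" s] by linarith
        then show ?thesis using x'(1)[of v] cpos s by (auto simp: H_def)
      qed
      have supp: "{v. H s x v \<noteq> 0} \<subseteq> ?S"
        using True by (auto simp: H_def split: if_splits)
      have "(\<Sum>v | H s x v \<noteq> 0. H s x v) = (\<Sum>v\<in>?S. H s x v)"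
        using supp finS by (intro sum.mono_neutral_left) auto
      also have "\<dots> = (\<Sum>v\<in>?S. x v) - (\<Sum>v\<in>?S. if v \<in> \<sigma> then s * c x else 0)
          + (\<Sum>v\<in>?S. if v = w then s * (card \<sigma> * c x) else 0)"
        by (simp add: H_def sum.distrib sum_subtractf)
      also have "(\<Sum>v\<in>?S. x v) = 1"
        unfolding x'(4)[symmetric] using finS by (intro sum.mono_neutral_right) auto
      also have "(\<Sum>v\<in>?S. if v \<in> \<sigma> then s * c x else 0) = (\<Sum>v\<in>\<sigma>. s * c x)"
        using True finS by (intro sum.mono_neutral_cong_right) auto
      also have "(\<Sum>v\<in>?S. if v = w then s * (card \<sigma> * c x) else 0) = s * (card \<sigma> * c x)"
        using finS by (subst sum.delta) auto
      finally have total: "(\<Sum>v | H s x v \<noteq> 0. H s x v) = 1" by simp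
      have inK: "{v. H s x v \<noteq> 0} \<in> K"
        using K SK supp unfolding subset_closed_def by blast
      moreover have "{v. H s x v \<noteq> 0} \<in> K'" if "s = 1"
      proof -
        obtain v where "v \<in> \<sigma>" "x v = c x" using c_attained by blast
        then have "v \<in> \<sigma>" "H s x v = 0" using \<sigma> that by (auto simp: H_def)
        then show ?thesis using inK by (auto simp: K' delete_star_def)
      qed
      ultimately show ?thesis
        using nonneg total finite_subset[OF supp finS] by (auto simp: topspace_geometric_realization)
    qed
    then show "H s x \<in> topspace ?X" "s = 1 \<Longrightarrow> H s x \<in> topspace ?Y" by auto
  qed
  have c_cont: "continuous_map ?X euclideanreal c"
    unfolding c_def using \<sigma>(1,2)
    by (intro continuous_map_Min continuous_map_realization_coordinate)
  have H_cont: "continuous_map (prod_topology (top_of_set {0..1}) ?X) ?X (\<lambda>z. H (fst z) (snd z))"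
  proof -
    have fst: "continuous_map (prod_topology (top_of_set {0..1}) ?X) euclideanreal fst"
      by (metis continuous_map_fst continuous_map_into_fulltopology)
    have snd: "continuous_map (prod_topology (top_of_set {0..1::real}) ?X) euclideanreal (\<lambda>z. f (snd z))"
      if "continuous_map ?X euclideanreal f" for f
      using continuous_map_compose[OF continuous_map_snd that] by (simp add: o_def)
    have if_cont: "continuous_map (prod_topology (top_of_set {0..1::real}) ?X) euclideanreal
        (\<lambda>z. if b then f z else 0)"
      if "continuous_map (prod_topology (top_of_set {0..1}) ?X) euclideanreal f" for b f
      using that by (cases b) auto
    have "continuous_map (prod_topology (top_of_set {0..1}) ?X) euclideanreal
        (\<lambda>z. H (fst z) (snd z) v)" for v
      unfolding H_def
      by (intro continuous_map_add continuous_map_diff if_cont continuous_map_real_mult fst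
          snd[OF c_cont] snd[OF continuous_map_realization_coordinate]) simp
    then show ?thesis
      using H_in(1) by (auto simp: continuous_map_into_realization)
  qed
  have "homotopic_with (\<lambda>_. True) ?X ?X id (H 1)"
    unfolding homotopic_with_def
    using H_cont by (intro exI[of _ "\<lambda>z. H (fst z) (snd z)"]) (simp add: H_def fun_eq_iff)
  then have hom: "homotopic_with (\<lambda>_. True) ?X ?X (H 1) id"
    by (rule homotopic_with_symD)
  have "continuous_map ?X ?X (H 1)"
    using hom homotopic_with_imp_continuous_maps by blast
  then have r: "continuous_map ?X ?Y (H 1)"
    using H_in(2)[of _ 1] by (simp add: continuous_map_into_realization Pi_iff)
  have sub: "topspace ?Y \<subseteq> topspace ?X"
    by (auto simp: topspace_geometric_realization K' delete_star_def)
  then have "continuous_map ?Y ?X id"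
    by (simp add: continuous_map_into_realization continuous_map_realization_coordinate
        Pi_iff subset_iff)
  moreover have "H 1 x = x" if "x \<in> topspace ?Y" for x
  proof -
    have "x \<in> topspace ?X" "\<not> \<sigma> \<subseteq> {v. x v \<noteq> 0}"
      using that sub by (auto simp: topspace_geometric_realization K' delete_star_def)
    then show ?thesis using c0 by (simp add: H_def fun_eq_iff)
  qed
  ultimately have "retraction_maps ?X ?Y (H 1) id"
    using r by (simp add: retraction_maps_def)
  with hom show ?thesis by (rule deformation_retract_imp_homotopy_equivalent_space)
qed

lemma subset_closed_delete_star: "subset_closed K \<Longrightarrow> subset_closed (delete_star K \<sigma>)"
  unfolding subset_closed_def delete_star_def by blast

lemma collapses_subset: "collapses K M \<Longrightarrow> M \<subseteq> K"
  by (induction rule: rtranclp_induct) (auto simp: cone_step_def delete_star_def)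

lemma collapses_subset_closed: "collapses K M \<Longrightarrow> subset_closed K \<Longrightarrow> subset_closed M"
  by (induction rule: rtranclp_induct) (auto simp: cone_step_def subset_closed_delete_star)

lemma collapses_homotopy_equivalent:
  "collapses K M \<Longrightarrow> subset_closed K \<Longrightarrow>
     geometric_realization K homotopy_equivalent_space geometric_realization M"
proof (induction rule: rtranclp_induct)
  case (step L M)
  then show ?case
    using cone_step_homotopy_equivalent collapses_subset_closed homotopy_eqv_trans by blast
qed (rule homotopy_equivalent_space_refl)

text \<open>
Several cone removals can be made one after the other, in any order, if no apex belongs to any of
the removed faces: adding an apex then never produces a face that is already gone.
\<close>

lemma collapse_cones:
  assumes "finite I" "\<And>i. i \<in> I \<Longrightarrow> finite (S i)" "\<And>i. i \<in> I \<Longrightarrow> S i \<noteq> {}"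
    and "\<And>i j. i \<in> I \<Longrightarrow> j \<in> I \<Longrightarrow> w i \<notin> S j"
    and "\<And>i \<tau>. i \<in> I \<Longrightarrow> \<tau> \<in> K \<Longrightarrow> S i \<subseteq> \<tau> \<Longrightarrow> insert (w i) \<tau> \<in> K"
  shows "collapses K {\<tau> \<in> K. \<forall>i\<in>I. \<not> S i \<subseteq> \<tau>}"
  using assms
proof (induction I)
  case (insert i I)
  let ?L = "{\<tau> \<in> K. \<forall>j\<in>I. \<not> S j \<subseteq> \<tau>}"
  have "insert (w i) \<tau> \<in> ?L" if \<tau>: "\<tau> \<in> ?L" "S i \<subseteq> \<tau>" for \<tau>
  proof -
    have "insert (w i) \<tau> \<in> K" using \<tau> insert.prems(4) by blast
    moreover have "\<not> S j \<subseteq> insert (w i) \<tau>" if "j \<in> I" for j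
      using \<tau> that insert.prems(3)[of i j] by blast
    ultimately show ?thesis by blast
  qed
  then have "cone_step ?L (delete_star ?L (S i))"
    unfolding cone_step_def using insert.prems(1,2,3)
    by (intro exI[of _ "S i"] exI[of _ "w i"]) auto
  moreover have "delete_star ?L (S i) = {\<tau> \<in> K. \<forall>j\<in>insert i I. \<not> S j \<subseteq> \<tau>}"
    by (auto simp: delete_star_def)
  moreover have "collapses K ?L"
    using insert.prems by (intro insert.IH) auto
  ultimately show ?case by (metis (no_types, lifting) rtranclp.rtrancl_into_rtrancl)
qed simp

definition link :: "'v set set \<Rightarrow> 'v set \<Rightarrow> 'v set set" where
  "link K \<sigma> = {\<tau>. \<tau> \<inter> \<sigma> = {} \<and> \<tau> \<union> \<sigma> \<in> K}"

text \<open>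
Removing \<open>\<rho>\<close> with apex \<open>w\<close> in the link of \<open>\<sigma>\<close> amounts to removing \<open>\<sigma> \<union> \<rho>\<close> with the same apex in
\<open>K\<close>, and this leaves the faces that do not contain \<open>\<sigma>\<close> alone.
\<close>

lemma collapse_link:
  assumes "collapses (link K \<sigma>) M" and "finite \<sigma>"
  shows "collapses K {\<tau> \<in> K. \<sigma> \<subseteq> \<tau> \<longrightarrow> \<tau> - \<sigma> \<in> M}"
  using assms(1)
proof (induction rule: rtranclp_induct)
  case base
  have "{\<tau> \<in> K. \<sigma> \<subseteq> \<tau> \<longrightarrow> \<tau> - \<sigma> \<in> link K \<sigma>} = K"
    by (auto simp: link_def Un_absorb2)
  then show ?case by simp
next
  case (step M M')
  let ?K = "\<lambda>M. {\<tau> \<in> K. \<sigma> \<subseteq> \<tau> \<longrightarrow> \<tau> - \<sigma> \<in> M}"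
  have M: "M \<subseteq> link K \<sigma>" using collapses_subset step.hyps(1) by blast
  obtain \<rho> w where \<rho>: "finite \<rho>" "\<rho> \<noteq> {}" "w \<notin> \<rho>" and M': "M' = delete_star M \<rho>"
    and cone: "\<And>\<tau>. \<tau> \<in> M \<Longrightarrow> \<rho> \<subseteq> \<tau> \<Longrightarrow> insert w \<tau> \<in> M"
    using step.hyps(2) unfolding cone_step_def by blast
  show ?case
  proof (cases "\<exists>\<tau>\<in>M. \<rho> \<subseteq> \<tau>")
    case False
    then have "M' = M" by (auto simp: M' delete_star_def)
    then show ?thesis using step.IH by simp
  next
    case True
    then obtain \<tau>0 where \<tau>0: "\<tau>0 \<in> M" "\<rho> \<subseteq> \<tau>0" by blast
    then have disj: "w \<notin> \<sigma>" "\<rho> \<inter> \<sigma> = {}"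
      using M cone[OF \<tau>0] by (auto simp: link_def)
    have "insert w \<tau> \<in> ?K M" if \<tau>: "\<tau> \<in> ?K M" "\<sigma> \<union> \<rho> \<subseteq> \<tau>" for \<tau>
    proof -
      have "insert w (\<tau> - \<sigma>) \<in> M" using \<tau> disj by (intro cone) auto
      moreover have "insert w \<tau> - \<sigma> = insert w (\<tau> - \<sigma>)" using disj by auto
      moreover have "insert w (\<tau> - \<sigma>) \<union> \<sigma> = insert w \<tau>" using \<tau> by auto
      ultimately show ?thesis using M by (auto simp: link_def)
    qed
    then have "cone_step (?K M) (delete_star (?K M) (\<sigma> \<union> \<rho>))"
      unfolding cone_step_def using \<rho> disj assms(2)
      by (intro exI[of _ "\<sigma> \<union> \<rho>"] exI[of _ w]) auto
    moreover have "delete_star (?K M) (\<sigma> \<union> \<rho>) = ?K M'"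
      using disj by (auto simp: M' delete_star_def)
    ultimately show ?thesis using step.IH
      by (metis (no_types, lifting) rtranclp.rtrancl_into_rtrancl)
  qed
qed

text \<open>
A single vertex still has the empty face.
\<close>

definition collapsible :: "'v set set \<Rightarrow> bool" where
  "collapsible K \<longleftrightarrow> (\<exists>w. collapses K {{}, {w}})"

lemma collapsible_trans: "collapses K M \<Longrightarrow> collapsible M \<Longrightarrow> collapsible K"
  unfolding collapsible_def using rtranclp_trans[of cone_step K M] by blast

text \<open>
Once the link of \<open>\<sigma>\<close> has been collapsed to a vertex \<open>w\<close>, the only faces left above \<open>\<sigma>\<close> are \<open>\<sigma>\<close> and
\<open>insert w \<sigma>\<close>, and they can be removed together.
\<close>

lemma collapse_collapsible_link:
  assumes "collapsible (link K \<sigma>)" "finite \<sigma>" "\<sigma> \<noteq> {}"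
  shows "collapses K (delete_star K \<sigma>)"
proof -
  obtain w where w: "collapses (link K \<sigma>) {{}, {w}}"
    using assms(1) unfolding collapsible_def by blast
  let ?L = "{\<tau> \<in> K. \<sigma> \<subseteq> \<tau> \<longrightarrow> \<tau> - \<sigma> \<in> {{}, {w}}}"
  have "{w} \<in> link K \<sigma>" using collapses_subset[OF w] by blast
  then have wl: "w \<notin> \<sigma>" "insert w \<sigma> \<in> K" by (auto simp: link_def)
  have "insert w \<tau> \<in> ?L" if "\<tau> \<in> ?L" "\<sigma> \<subseteq> \<tau>" for \<tau>
  proof -
    have "\<tau> - \<sigma> = {} \<or> \<tau> - \<sigma> = {w}" using that by blast
    then have "insert w \<tau> = insert w \<sigma>" using that(2) by blast
    moreover have "insert w \<sigma> - \<sigma> = {w}" using wl(1) by blast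
    ultimately show ?thesis using wl(2) by (simp only: mem_Collect_eq insert_iff) simp
  qed
  then have "\<forall>\<tau>\<in>?L. \<sigma> \<subseteq> \<tau> \<longrightarrow> insert w \<tau> \<in> ?L" by (intro ballI impI)
  then have "cone_step ?L (delete_star ?L \<sigma>)"
    unfolding cone_step_def
    by (intro exI[of _ \<sigma>] exI[of _ w] conjI assms(2,3) wl(1) refl)
  moreover have "delete_star ?L \<sigma> = delete_star K \<sigma>" by (auto simp: delete_star_def)
  ultimately show ?thesis
    using collapse_link[OF w assms(2)] by (metis (no_types, lifting) rtranclp.rtrancl_into_rtrancl)
qed

lemma cone_collapsible:
  assumes "finite (\<Union>K)" "subset_closed K" "{w} \<in> K" "\<And>\<tau>. \<tau> \<in> K \<Longrightarrow> insert w \<tau> \<in> K"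
  shows "collapsible K"
proof -
  have "collapses K {\<tau> \<in> K. \<forall>v\<in>\<Union>K - {w}. \<not> {v} \<subseteq> \<tau>}"
    using assms by (intro collapse_cones[where w = "\<lambda>_. w"]) auto
  moreover have "{\<tau> \<in> K. \<forall>v\<in>\<Union>K - {w}. \<not> {v} \<subseteq> \<tau>} = {{}, {w}}"
  proof -
    have "{\<tau> \<in> K. \<forall>v\<in>\<Union>K - {w}. \<not> {v} \<subseteq> \<tau>} = {\<tau> \<in> K. \<tau> \<subseteq> {w}}" by auto
    also have "\<dots> = {{}, {w}}"
      using assms(2,3) unfolding subset_closed_def by (auto simp: subset_singleton_iff)
    finally show ?thesis .
  qed
  ultimately show ?thesis unfolding collapsible_def by metis
qed

section \<open>Cones attached to a collapsible base\<close>

text \<open>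
The boundary of the cross-polytope in dimension \<open>n\<close>: the vertices \<open>(j, True)\<close> and \<open>(j, False)\<close> stand
for the two opposite unit vectors on the axis \<open>j\<close>, and a face contains no two opposite vertices. For
\<open>n = 0\<close> only the empty face remains, the sphere of dimension \<open>-1\<close>.
\<close>

definition crosspolytope :: "nat \<Rightarrow> (nat \<times> bool) set set" where
  "crosspolytope n = {T. T \<subseteq> {..<n} \<times> UNIV \<and> (\<forall>j. (j, True) \<notin> T \<or> (j, False) \<notin> T)}"

definition bouquet :: "nat \<Rightarrow> nat \<Rightarrow> (nat \<Rightarrow> nat \<times> bool \<Rightarrow> 'v) \<Rightarrow> 'v set set" where
  "bouquet k n lab = (\<Union>r\<in>{1..k}. (`) (lab r) ` crosspolytope (Suc n))"

text \<open>
The \<open>k\<close> copies share the image of the vertex \<open>(0, True)\<close>, and nothing else.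
\<close>

definition bouquet_labelling :: "nat \<Rightarrow> nat \<Rightarrow> (nat \<Rightarrow> nat \<times> bool \<Rightarrow> 'v) \<Rightarrow> bool" where
  "bouquet_labelling k n lab \<longleftrightarrow>
     (\<forall>r\<in>{1..k}. inj_on (lab r) ({..n} \<times> UNIV)) \<and>
     (\<forall>r\<in>{1..k}. \<forall>s\<in>{1..k}. lab r (0, True) = lab s (0, True)) \<and>
     (\<forall>r\<in>{1..k}. \<forall>s\<in>{1..k}. \<forall>x\<in>{..n} \<times> UNIV. \<forall>y\<in>{..n} \<times> UNIV.
        lab r x = lab s y \<longrightarrow> r = s \<or> x = (0, True) \<and> y = (0, True))"

lemma bouquet_labelling_inj:
  "bouquet_labelling k n lab \<Longrightarrow> r \<in> {1..k} \<Longrightarrow> inj_on (lab r) ({..n} \<times> UNIV)"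
  by (simp add: bouquet_labelling_def)

lemma bouquet_labelling_basepoint:
  "bouquet_labelling k n lab \<Longrightarrow> r \<in> {1..k} \<Longrightarrow> s \<in> {1..k} \<Longrightarrow> lab r (0, True) = lab s (0, True)"
  unfolding bouquet_labelling_def by blast

lemma bouquet_labelling_disjoint:
  assumes "bouquet_labelling k n lab" "r \<in> {1..k}" "s \<in> {1..k}" "r \<noteq> s"
    and "x \<in> {..n} \<times> UNIV" "y \<in> {..n} \<times> UNIV" "lab r x = lab s y"
  shows "x = (0, True)"
  using assms unfolding bouquet_labelling_def by blast

lemma empty_in_crosspolytope: "{} \<in> crosspolytope n"
  by (simp add: crosspolytope_def)

lemma singleton_in_crosspolytope: "x \<in> {..<n} \<times> UNIV \<Longrightarrow> {x} \<in> crosspolytope n"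
  by (auto simp: crosspolytope_def)

lemma subset_in_crosspolytope: "T \<in> crosspolytope n \<Longrightarrow> T' \<subseteq> T \<Longrightarrow> T' \<in> crosspolytope n"
  unfolding crosspolytope_def by blast

abbreviation shift :: "nat \<times> bool \<Rightarrow> nat \<times> bool" where
  "shift \<equiv> map_prod Suc id"

text \<open>
The boundary of the next cross-polytope is the suspension with the poles \<open>(0, True)\<close> and \<open>(0, False)\<close>.
\<close>

lemma crosspolytope_Suc:
  "T \<in> crosspolytope (Suc n) \<longleftrightarrow>
     (\<exists>T0\<in>crosspolytope n. T = shift ` T0 \<or> (\<exists>b. T = insert (0, b) (shift ` T0)))"
proof
  assume T: "T \<in> crosspolytope (Suc n)"
  let ?T0 = "{(j, b). (Suc j, b) \<in> T}"
  have T0: "?T0 \<in> crosspolytope n" using T by (auto simp: crosspolytope_def)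
  have "x \<in> shift ` ?T0" if x: "x \<in> T" "fst x \<noteq> 0" for x
  proof -
    obtain j b where "x = (Suc j, b)" using x(2) by (metis fst_conv not0_implies_Suc surj_pair)
    then show ?thesis using x(1) by (force simp: image_iff)
  qed
  then have eq: "T = (T \<inter> {0} \<times> UNIV) \<union> shift ` ?T0" by force
  have "T \<inter> {0} \<times> UNIV = {} \<or> (\<exists>b. T \<inter> {0} \<times> UNIV = {(0, b)})"
  proof (cases "\<exists>b. (0, b) \<in> T")
    case True
    then obtain b where b: "(0, b) \<in> T" by blast
    then have "(0, \<not> b) \<notin> T" using T by (cases b) (auto simp: crosspolytope_def)
    then have "b' = b" if "(0, b') \<in> T" for b'
      using that b by (cases b; cases b') auto
    then have "T \<inter> {0} \<times> UNIV = {(0, b)}" using b by blast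
    then show ?thesis by blast
  qed auto
  then show "\<exists>T0\<in>crosspolytope n. T = shift ` T0 \<or> (\<exists>b. T = insert (0, b) (shift ` T0))"
    using T0 eq by (metis Un_insert_left sup_bot_left)
next
  assume "\<exists>T0\<in>crosspolytope n. T = shift ` T0 \<or> (\<exists>b. T = insert (0, b) (shift ` T0))"
  then show "T \<in> crosspolytope (Suc n)"
    by (auto simp: crosspolytope_def image_iff map_prod_def split: prod.splits)
qed

text \<open>
Up to homotopy, attaching cones with apices \<open>v r\<close> over spheres to a contractible base gives a wedge of
suspensions. To see this by cone removals only, collapse each link to a cross-polytope inside
the base \<open>L\<close>, cone off \<open>L\<close> by a new vertex \<open>star\<close>, and add, for each \<open>r\<close> separately, a new twin
\<open>new r x\<close> of every vertex \<open>l r x\<close> of the \<open>r\<close>-th cross-polytope. The resulting complex \<open>Big\<close> collapses in two ways.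
Dropping the twins and then \<open>star\<close> leads to the given complex with its links shrunk. Dropping instead the
old vertices from the links of the \<open>v r\<close>, so that only the twins remain there, makes these links
disjoint; then the part of the cone over the base that lies over none of them can be
removed with apex \<open>star\<close>. What is left are the suspensions of the twin cross-polytopes with poles
\<open>star\<close> and \<open>v r\<close>. An infinite vertex type provides the new vertices.
\<close>

lemma bouquet_of_cones:
  fixes K :: "'v set set" and v :: "nat \<Rightarrow> 'v" and l :: "nat \<Rightarrow> nat \<times> bool \<Rightarrow> 'v"
  assumes inf: "infinite (UNIV :: 'v set)" and k: "0 < k"
    and fin: "finite (\<Union>K)" and K: "subset_closed K"
    and apart: "\<And>r s \<sigma>. r \<in> {1..k} \<Longrightarrow> s \<in> {1..k} \<Longrightarrow> \<sigma> \<in> K \<Longrightarrow> v r \<in> \<sigma> \<Longrightarrow> v s \<in> \<sigma> \<Longrightarrow> r = s"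
    and base: "collapsible {\<sigma> \<in> K. \<sigma> \<inter> v ` {1..k} = {}}"
    and links: "\<And>r. r \<in> {1..k} \<Longrightarrow> collapses (link K {v r}) ((`) (l r) ` crosspolytope n)"
    and inj: "\<And>r. r \<in> {1..k} \<Longrightarrow> inj_on (l r) ({..<n} \<times> UNIV)"
  shows "\<exists>lab :: nat \<Rightarrow> nat \<times> bool \<Rightarrow> 'v. bouquet_labelling k n lab \<and>
           geometric_realization K homotopy_equivalent_space geometric_realization (bouquet k n lab)"
proof -
  define X :: "(nat \<times> bool) set" where "X = {..<n} \<times> UNIV"
  define C where "C r = (`) (l r) ` crosspolytope n" for r
  define L where "L = {\<sigma> \<in> K. \<sigma> \<inter> v ` {1..k} = {}}"
  have C_link: "C r \<subseteq> link K {v r}" if "r \<in> {1..k}" for r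
    using collapses_subset[OF links[OF that]] by (simp add: C_def)
  have C_insert: "insert (v r) \<rho> \<in> K" "v r \<notin> \<rho>" if "r \<in> {1..k}" "\<rho> \<in> C r" for r \<rho>
    using C_link[OF that(1)] that(2) by (auto simp: link_def)
  have C_L: "\<rho> \<in> L" if r: "r \<in> {1..k}" and \<rho>: "\<rho> \<in> C r" for r \<rho>
  proof -
    have "\<rho> \<in> K" using C_insert[OF r \<rho>] K unfolding subset_closed_def by blast
    moreover have "v s \<notin> \<rho>" if "s \<in> {1..k}" for s
      using C_insert[OF r \<rho>] apart[OF r that C_insert(1)[OF r \<rho>]] by blast
    ultimately show ?thesis by (auto simp: L_def)
  qed
  have C_mem: "l r ` T \<in> C r" if "T \<in> crosspolytope n" for r T
    using that by (simp add: C_def)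
  have v_K: "v r \<in> \<Union>K" if "r \<in> {1..k}" for r
    using C_insert(1)[OF that C_mem[OF empty_in_crosspolytope]] by blast
  have l_L: "l r x \<in> \<Union>L" if "r \<in> {1..k}" "x \<in> X" for r x
    using C_L[OF that(1) C_mem[OF singleton_in_crosspolytope]] that(2) X_def by blast
  have v_L: "v r \<notin> \<sigma>" if "r \<in> {1..k}" "\<sigma> \<in> L" for r \<sigma>
    using that by (auto simp: L_def)
  have L_closed: "\<sigma>' \<in> L" if "\<sigma> \<in> L" "\<sigma>' \<subseteq> \<sigma>" for \<sigma> \<sigma>'
    using that K unfolding L_def subset_closed_def by blast

  have "infinite (- \<Union>K)"
    using inf fin by (simp add: Compl_eq_Diff_UNIV)
  then obtain f :: "nat \<Rightarrow> 'v" where f: "inj f" "range f \<subseteq> - \<Union>K"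
    using infinite_countable_subset[of "- \<Union>K"] by metis
  define g :: "(nat \<times> nat \<times> bool) option \<Rightarrow> 'v" where "g = f \<circ> to_nat"
  have g: "inj g" using f(1) by (simp add: g_def inj_compose)
  have gK: "g z \<notin> \<Union>K" for z
    using f(2) by (auto simp: g_def)
  define star where "star = g None"
  define new where "new r x = g (Some (r, x))" for r x
  have new_eq: "new r x = new s y \<longleftrightarrow> r = s \<and> x = y" for r s x y
    using g by (auto simp: new_def inj_eq)
  have new_star: "new r x \<noteq> star" for r x
    using g by (auto simp: new_def star_def inj_eq)
  have new_K: "new r x \<notin> \<Union>K" and star_K: "star \<notin> \<Union>K" for r x
    using gK by (auto simp: new_def star_def)
  have LK: "\<Union>L \<subseteq> \<Union>K" by (auto simp: L_def)
  have v_new: "v r \<noteq> new s x" "v r \<noteq> star" if "r \<in> {1..k}" for r s x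
    using v_K[OF that] new_K star_K by metis+

  \<comment> \<open>\<open>P\<close> is the cone over the base with twins, \<open>Q r\<close> the \<open>r\<close>-th cross-polytope with twins.
    A twin may lie in a face along with the vertex that it duplicates.\<close>
  define N where "N \<rho> = {new r x | r x. r \<in> {1..k} \<and> x \<in> X \<and> l r x \<in> \<rho>}" for \<rho>
  define P where "P = {\<sigma>. \<exists>\<rho>\<in>L. \<sigma> \<subseteq> insert star (\<rho> \<union> N \<rho>)}"
  define Q where "Q r = {\<tau>. \<exists>T\<in>crosspolytope n. \<tau> \<subseteq> l r ` T \<union> new r ` T}" for r
  define Big where "Big = P \<union> (\<Union>r\<in>{1..k}. insert (v r) ` Q r)"
  have v_P: "v r \<notin> \<sigma>" if r: "r \<in> {1..k}" and \<sigma>: "\<sigma> \<in> P" for r \<sigma>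
  proof -
    obtain \<rho> where "\<rho> \<in> L" "\<sigma> \<subseteq> insert star (\<rho> \<union> N \<rho>)" using \<sigma> unfolding P_def by blast
    moreover have "v r \<notin> N \<rho>" unfolding N_def using v_new(1)[OF r] by blast
    ultimately show ?thesis using v_L[OF r] v_new(2)[OF r] by blast
  qed
  have TX: "T \<subseteq> X" if "T \<in> crosspolytope n" for T
    using that by (auto simp: crosspolytope_def X_def)
  have QP: "\<tau> \<in> P" if r: "r \<in> {1..k}" and \<tau>: "\<tau> \<in> Q r" for r \<tau>
  proof -
    obtain T where T: "T \<in> crosspolytope n" "\<tau> \<subseteq> l r ` T \<union> new r ` T" using \<tau> by (auto simp: Q_def)
    have "new r ` T \<subseteq> N (l r ` T)"
      using TX[OF T(1)] r unfolding N_def by blast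
    then have "\<tau> \<subseteq> insert star (l r ` T \<union> N (l r ` T))"
      using T(2) by blast
    then show ?thesis using C_L[OF r C_mem[OF T(1)]] unfolding P_def by blast
  qed
  have P_star: "insert star \<sigma> \<in> P" if \<sigma>: "\<sigma> \<in> P" for \<sigma>
  proof -
    obtain \<rho> where "\<rho> \<in> L" "\<sigma> \<subseteq> insert star (\<rho> \<union> N \<rho>)" using \<sigma> unfolding P_def by blast
    then show ?thesis unfolding P_def by blast
  qed
  have Big_closed: "subset_closed Big"
  proof -
    have "\<tau> \<in> Big" if "\<sigma> \<in> P" "\<tau> \<subseteq> \<sigma>" for \<sigma> \<tau>
      using that unfolding Big_def P_def by blast
    moreover have "\<tau> \<in> Big" if r: "r \<in> {1..k}" "\<sigma> \<in> Q r" "\<tau> \<subseteq> insert (v r) \<sigma>" for \<sigma> \<tau> r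
    proof -
      have Q: "\<tau> - {v r} \<in> Q r" using r(2,3) unfolding Q_def by blast
      show ?thesis
      proof (cases "v r \<in> \<tau>")
        case True
        then have "\<tau> = insert (v r) (\<tau> - {v r})" by blast
        then show ?thesis using Q r(1) unfolding Big_def by blast
      next
        case False
        then show ?thesis using Q QP[OF r(1)] by (simp add: Big_def)
      qed
    qed
    moreover have "\<sigma> \<in> P \<or> (\<exists>r\<in>{1..k}. \<exists>\<tau>\<in>Q r. \<sigma> = insert (v r) \<tau>)" if "\<sigma> \<in> Big" for \<sigma>
      using that by (auto simp: Big_def)
    ultimately show ?thesis unfolding subset_closed_def by metis
  qed

  \<comment> \<open>The given complex with every link shrunk to a cross-polytope.\<close>
  define K1 where "K1 = {\<sigma> \<in> K. \<forall>r\<in>{1..k}. v r \<in> \<sigma> \<longrightarrow> \<sigma> - {v r} \<in> C r}"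
  have K_K1: "collapses K K1"
  proof -
    have "collapses K {\<sigma> \<in> K. \<forall>r\<in>R. v r \<in> \<sigma> \<longrightarrow> \<sigma> - {v r} \<in> C r}" if "finite R" "R \<subseteq> {1..k}" for R
      using that
    proof (induction R)
      case (insert r R)
      let ?K = "\<lambda>R. {\<sigma> \<in> K. \<forall>r\<in>R. v r \<in> \<sigma> \<longrightarrow> \<sigma> - {v r} \<in> C r}"
      have r: "r \<in> {1..k}" "R \<subseteq> {1..k}" using insert.prems by auto
      have "\<tau> \<union> {v r} \<in> ?K R" if "\<tau> \<union> {v r} \<in> K" for \<tau>
        using that insert.hyps(2) r apart[OF r(1) _ that] by blast
      then have "link (?K R) {v r} = link K {v r}"
        unfolding link_def by blast
      then have "collapses (?K R) {\<tau> \<in> ?K R. {v r} \<subseteq> \<tau> \<longrightarrow> \<tau> - {v r} \<in> C r}"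
        using links[OF r(1)] by (intro collapse_link) (auto simp: C_def)
      moreover have "{\<tau> \<in> ?K R. {v r} \<subseteq> \<tau> \<longrightarrow> \<tau> - {v r} \<in> C r} = ?K (insert r R)" by auto
      ultimately show ?case using insert.IH[OF r(2)] by (metis (no_types, lifting) rtranclp_trans)
    qed simp
    then show ?thesis unfolding K1_def by blast
  qed
  have K1_eq: "K1 = L \<union> (\<Union>r\<in>{1..k}. insert (v r) ` C r)"
  proof
    show "K1 \<subseteq> L \<union> (\<Union>r\<in>{1..k}. insert (v r) ` C r)"
    proof
      fix \<sigma> assume \<sigma>: "\<sigma> \<in> K1"
      show "\<sigma> \<in> L \<union> (\<Union>r\<in>{1..k}. insert (v r) ` C r)"
      proof (cases "\<exists>r\<in>{1..k}. v r \<in> \<sigma>")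
        case True
        then obtain r where r: "r \<in> {1..k}" "v r \<in> \<sigma>" by blast
        then have "\<sigma> - {v r} \<in> C r" "\<sigma> = insert (v r) (\<sigma> - {v r})" using \<sigma> by (auto simp: K1_def)
        then show ?thesis using r by blast
      next
        case False
        then show ?thesis using \<sigma> by (auto simp: K1_def L_def)
      qed
    qed
    have "insert (v r) \<rho> \<in> K1" if r: "r \<in> {1..k}" "\<rho> \<in> C r" for r \<rho>
    proof -
      have "insert (v r) \<rho> - {v s} \<in> C s" if "s \<in> {1..k}" "v s \<in> insert (v r) \<rho>" for s
        using apart[OF r(1) that(1) C_insert(1)[OF r]] that C_insert(2)[OF r] r by auto
      then show ?thesis using C_insert[OF r] by (auto simp: K1_def)
    qed
    then show "L \<union> (\<Union>r\<in>{1..k}. insert (v r) ` C r) \<subseteq> K1"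
      by (auto simp: K1_def L_def)
  qed

  have Big_K1: "collapses Big K1"
  proof -
    \<comment> \<open>\<open>Big\<close> without twins: each twin is dominated by the vertex that it duplicates.\<close>
    define K2 where "K2 = {\<tau> \<in> Big. \<forall>p\<in>{1..k} \<times> X. \<not> {new (fst p) (snd p)} \<subseteq> \<tau>}"
    have "insert (l r x) \<tau> \<in> Big" if rx: "r \<in> {1..k}" "x \<in> X" and \<tau>: "\<tau> \<in> Big" "new r x \<in> \<tau>" for r x \<tau>
      using \<tau>(1) unfolding Big_def
    proof (elim UnE UN_E imageE)
      assume "\<tau> \<in> P"
      then obtain \<rho> where \<rho>: "\<rho> \<in> L" "\<tau> \<subseteq> insert star (\<rho> \<union> N \<rho>)" by (auto simp: P_def)
      moreover have "new r x \<notin> \<rho>" using \<rho>(1) LK new_K[of r x] by blast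
      ultimately have "new r x \<in> N \<rho>" using \<tau>(2) new_star by blast
      then have "l r x \<in> \<rho>"
        unfolding N_def mem_Collect_eq new_eq by blast
      then show "insert (l r x) \<tau> \<in> P \<union> (\<Union>r\<in>{1..k}. insert (v r) ` Q r)"
        using \<rho> unfolding P_def by blast
    next
      fix s \<tau>' assume s: "s \<in> {1..k}" "\<tau>' \<in> Q s" "\<tau> = insert (v s) \<tau>'"
      then obtain T where T: "T \<in> crosspolytope n" "\<tau>' \<subseteq> l s ` T \<union> new s ` T" by (auto simp: Q_def)
      have "l s ` T \<subseteq> \<Union>K" using C_L[OF s(1) C_mem[OF T(1)]] LK by blast
      then have "new r x \<notin> l s ` T" using new_K[of r x] by blast
      moreover have "new r x \<in> \<tau>'" using \<tau>(2) s v_new(1)[OF s(1), of r x] by auto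
      ultimately have "new r x \<in> new s ` T" using T(2) by blast
      then have "r = s" "x \<in> T" by (auto simp: new_eq)
      then have "insert (l r x) \<tau>' \<in> Q s" using T by (auto simp: Q_def)
      moreover have "insert (l r x) \<tau> = insert (v s) (insert (l r x) \<tau>')" using s(3) by blast
      ultimately show "insert (l r x) \<tau> \<in> P \<union> (\<Union>r\<in>{1..k}. insert (v r) ` Q r)"
        using s(1) by blast
    qed
    moreover have "l r x \<noteq> new s y" if "r \<in> {1..k}" "x \<in> X" for r s x y
      using l_L[OF that] new_K[of s y] LK by auto
    ultimately have Big_K2: "collapses Big K2"
      unfolding K2_def by (intro collapse_cones[where w = "\<lambda>p. l (fst p) (snd p)"]) (auto simp: X_def)
    have K2: "K2 = {\<sigma>. \<sigma> - {star} \<in> L} \<union> (\<Union>r\<in>{1..k}. insert (v r) ` C r)"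
    proof (intro equalityI subsetI)
      fix \<tau> assume "\<tau> \<in> K2"
      then have \<tau>: "\<tau> \<in> Big" "\<And>r x. r \<in> {1..k} \<Longrightarrow> x \<in> X \<Longrightarrow> new r x \<notin> \<tau>"
        by (auto simp: K2_def)
      show "\<tau> \<in> {\<sigma>. \<sigma> - {star} \<in> L} \<union> (\<Union>r\<in>{1..k}. insert (v r) ` C r)"
        using \<tau>(1) unfolding Big_def
      proof (elim UnE UN_E imageE)
        assume "\<tau> \<in> P"
        then obtain \<rho> where \<rho>: "\<rho> \<in> L" "\<tau> \<subseteq> insert star (\<rho> \<union> N \<rho>)" by (auto simp: P_def)
        then have "\<tau> - {star} \<subseteq> \<rho>" using \<tau>(2) by (auto simp: N_def)
        then show ?thesis using L_closed[OF \<rho>(1)] by simp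
      next
        fix s \<tau>' assume s: "s \<in> {1..k}" "\<tau>' \<in> Q s" "\<tau> = insert (v s) \<tau>'"
        then obtain T where T: "T \<in> crosspolytope n" "\<tau>' \<subseteq> l s ` T \<union> new s ` T" by (auto simp: Q_def)
        then have "\<tau>' \<subseteq> l s ` T" using \<tau>(2)[OF s(1)] s(3) TX[OF T(1)] by blast
        then obtain T' where "T' \<subseteq> T" "\<tau>' = l s ` T'" by (meson subset_image_iff)
        then have "\<tau>' \<in> C s" using C_mem subset_in_crosspolytope[OF T(1)] by blast
        then show ?thesis using s by blast
      qed
    next
      fix \<tau> assume \<tau>: "\<tau> \<in> {\<sigma>. \<sigma> - {star} \<in> L} \<union> (\<Union>r\<in>{1..k}. insert (v r) ` C r)"
      then have "\<tau> \<subseteq> insert star (\<Union>K)"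
        using C_insert(1) LK by blast
      then have "new r x \<notin> \<tau>" for r x using new_K[of r x] new_star[of r x] by blast
      moreover have "\<tau> \<in> Big"
        using \<tau>
      proof (elim UnE UN_E imageE)
        assume "\<tau> \<in> {\<sigma>. \<sigma> - {star} \<in> L}"
        then have "\<tau> \<in> P" unfolding P_def by (intro CollectI bexI[of _ "\<tau> - {star}"]) auto
        then show ?thesis unfolding Big_def by blast
      next
        fix s \<rho> assume "s \<in> {1..k}" "\<rho> \<in> C s" "\<tau> = insert (v s) \<rho>"
        moreover from this have "\<rho> \<in> Q s" by (auto simp: C_def Q_def)
        ultimately show ?thesis unfolding Big_def by blast
      qed
      ultimately show "\<tau> \<in> K2" by (auto simp: K2_def)
    qed
    have star_C: "star \<notin> insert (v r) \<rho>" if "r \<in> {1..k}" "\<rho> \<in> C r" for r \<rho>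
      using C_insert(1)[OF that] star_K by blast
    have "link K2 {star} = L"
    proof (intro equalityI subsetI)
      fix \<tau> assume "\<tau> \<in> link K2 {star}"
      then have \<tau>: "star \<notin> \<tau>" "insert star \<tau> \<in> K2" by (auto simp: link_def)
      then have "insert star \<tau> - {star} \<in> L" using star_C unfolding K2 by blast
      then show "\<tau> \<in> L" using \<tau>(1) by simp
    next
      fix \<tau> assume \<tau>: "\<tau> \<in> L"
      then have "star \<notin> \<tau>" using star_K LK by blast
      then show "\<tau> \<in> link K2 {star}" using \<tau> by (auto simp: link_def K2)
    qed
    then have "collapses K2 (delete_star K2 {star})"
      using base by (intro collapse_collapsible_link) (auto simp: L_def)
    with Big_K2 have "collapses Big (delete_star K2 {star})" by (rule rtranclp_trans)
    also have "delete_star K2 {star} = K1"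
    proof -
      have "delete_star K2 {star} = {\<sigma>. \<sigma> - {star} \<in> L \<and> star \<notin> \<sigma>} \<union> (\<Union>r\<in>{1..k}. insert (v r) ` C r)"
        using star_C unfolding K2 delete_star_def by blast
      also have "{\<sigma>. \<sigma> - {star} \<in> L \<and> star \<notin> \<sigma>} = L"
      proof -
        have "star \<notin> \<sigma>" if "\<sigma> \<in> L" for \<sigma> using that star_K LK by blast
        then show ?thesis by auto
      qed
      finally show ?thesis by (simp add: K1_eq)
    qed
    finally show ?thesis .
  qed

  define lab where "lab r z = (case z of (0, b) \<Rightarrow> if b then star else v r | (Suc j, b) \<Rightarrow> new r (j, b))"
    for r :: nat and z :: "nat \<times> bool"
  have lab_shift: "lab r ` shift ` T = new r ` T" for r T
    by (force simp: lab_def image_iff)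
  have bouquet_eq: "bouquet k n lab =
      {\<sigma>. \<exists>r\<in>{1..k}. \<exists>T\<in>crosspolytope n.
         \<sigma> = new r ` T \<or> \<sigma> = insert star (new r ` T) \<or> \<sigma> = insert (v r) (new r ` T)}" (is "_ = ?W")
  proof -
    have "(\<exists>T\<in>crosspolytope (Suc n). \<sigma> = lab r ` T) \<longleftrightarrow>
      (\<exists>T\<in>crosspolytope n. \<sigma> = new r ` T \<or> \<sigma> = insert star (new r ` T) \<or> \<sigma> = insert (v r) (new r ` T))"
      for r \<sigma>
    proof -
      have "lab r (0, True) = star" "lab r (0, False) = v r" by (auto simp: lab_def)
      then have "(\<exists>b. \<sigma> = lab r ` insert (0, b) (shift ` T)) \<longleftrightarrow>
          \<sigma> = insert star (new r ` T) \<or> \<sigma> = insert (v r) (new r ` T)" for T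
        by (simp add: lab_shift ex_bool_eq)
      then show ?thesis
        unfolding Bex_def crosspolytope_Suc using lab_shift by metis
    qed
    moreover have "bouquet k n lab = {\<sigma>. \<exists>r\<in>{1..k}. \<exists>T\<in>crosspolytope (Suc n). \<sigma> = lab r ` T}"
      by (auto simp: bouquet_def)
    ultimately show ?thesis by simp
  qed
  have labelling: "bouquet_labelling k n lab"
  proof -
    have "inj_on (lab r) ({..n} \<times> UNIV)" if "r \<in> {1..k}" for r
      using v_new[OF that] new_star
      by (auto simp: inj_on_def lab_def new_eq split: nat.splits if_splits) metis+
    moreover have "r = s \<or> x = (0, True) \<and> y = (0, True)"
      if r: "r \<in> {1..k}" and s: "s \<in> {1..k}" and "lab r x = lab s y" for r s x y
    proof -
      have "v r = v s \<Longrightarrow> r = s" using apart[OF r s] v_K[OF r] by auto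
      then show ?thesis
        using that(3) v_new[OF r] v_new[OF s] new_star
        by (cases x; cases y) (auto simp: lab_def new_eq split: nat.splits if_splits, metis+)
    qed
    ultimately show ?thesis
      unfolding bouquet_labelling_def by (auto simp: lab_def)
  qed

  have Big_bouquet: "collapses Big (bouquet k n lab)"
  proof -
    \<comment> \<open>Now the old vertices leave the links of the \<open>v r\<close>, where they are dominated by their twins.\<close>
    define B3 where "B3 = {\<tau> \<in> Big. \<forall>p\<in>{1..k} \<times> X. \<not> {v (fst p), l (fst p) (snd p)} \<subseteq> \<tau>}"
    have "insert (new r x) \<tau> \<in> Big"
      if rx: "r \<in> {1..k}" "x \<in> X" and \<tau>: "\<tau> \<in> Big" "v r \<in> \<tau>" "l r x \<in> \<tau>" for r x \<tau>
    proof -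
      have "\<tau> \<notin> P" using v_P[OF rx(1)] \<tau>(2) by blast
      then obtain s \<tau>' where s: "s \<in> {1..k}" "\<tau>' \<in> Q s" "\<tau> = insert (v s) \<tau>'"
        using \<tau>(1) by (auto simp: Big_def)
      have "v r \<notin> \<tau>'" using v_P[OF rx(1) QP[OF s(1,2)]] .
      then have "v r = v s" using \<tau>(2) s(3) by blast
      then have rs: "r = s" using apart[OF rx(1) s(1)] v_K[OF rx(1)] by auto
      obtain T where T: "T \<in> crosspolytope n" "\<tau>' \<subseteq> l s ` T \<union> new s ` T" using s(2) by (auto simp: Q_def)
      have "l r x \<noteq> v s" using l_L[OF rx] v_L[OF s(1)] by auto
      then have "l r x \<in> l s ` T \<union> new s ` T" using \<tau>(3) s(3) T(2) by auto
      moreover have "l r x \<notin> new s ` T" using l_L[OF rx] LK new_K by auto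
      ultimately have "l r x \<in> l r ` T" using rs by simp
      then have "x \<in> T" using inj[OF rx(1)] rx(2) TX[OF T(1)] unfolding X_def
        by (meson inj_on_image_mem_iff)
      then have "insert (new r x) \<tau>' \<in> Q s" using T rs by (auto simp: Q_def)
      moreover have "insert (new r x) \<tau> = insert (v s) (insert (new r x) \<tau>')" using s(3) by blast
      ultimately show ?thesis using s(1) unfolding Big_def by blast
    qed
    moreover have "new r x \<noteq> v s" "new r x \<noteq> l s y" if "s \<in> {1..k}" "y \<in> X" for r s x y
      using v_new(1)[OF that(1), of r x] l_L[OF that] LK new_K[of r x] by auto
    ultimately have Big_B3: "collapses Big B3"
      unfolding B3_def
      by (intro collapse_cones[where w = "\<lambda>p. new (fst p) (snd p)"]) (auto simp: X_def)
    have B3: "B3 = P \<union> {insert (v r) (new r ` T) | r T. r \<in> {1..k} \<and> T \<in> crosspolytope n}"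
    proof (intro equalityI subsetI)
      fix \<tau> assume "\<tau> \<in> B3"
      then have \<tau>: "\<tau> \<in> Big" "\<And>r x. r \<in> {1..k} \<Longrightarrow> x \<in> X \<Longrightarrow> v r \<in> \<tau> \<Longrightarrow> l r x \<notin> \<tau>"
        by (auto simp: B3_def)
      show "\<tau> \<in> P \<union> {insert (v r) (new r ` T) | r T. r \<in> {1..k} \<and> T \<in> crosspolytope n}"
        using \<tau>(1) unfolding Big_def
      proof (elim UnE UN_E imageE)
        fix s \<tau>' assume s: "s \<in> {1..k}" "\<tau>' \<in> Q s" "\<tau> = insert (v s) \<tau>'"
        then obtain T where T: "T \<in> crosspolytope n" "\<tau>' \<subseteq> l s ` T \<union> new s ` T" by (auto simp: Q_def)
        then have "\<tau>' \<subseteq> new s ` T" using \<tau>(2)[OF s(1)] s(3) TX[OF T(1)] by blast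
        then obtain T' where "T' \<subseteq> T" "\<tau>' = new s ` T'" by (meson subset_image_iff)
        then show ?thesis using s subset_in_crosspolytope[OF T(1)] by blast
      qed simp
    next
      fix \<tau> assume "\<tau> \<in> P \<union> {insert (v r) (new r ` T) | r T. r \<in> {1..k} \<and> T \<in> crosspolytope n}"
      then consider "\<tau> \<in> P" | r T where "r \<in> {1..k}" "T \<in> crosspolytope n" "\<tau> = insert (v r) (new r ` T)"
        by blast
      then show "\<tau> \<in> B3"
      proof cases
        case 1
        then show ?thesis using v_P by (auto simp: B3_def Big_def)
      next
        case 2
        have "l s x \<notin> \<tau>" if "s \<in> {1..k}" "x \<in> X" for s x
          using l_L[OF that] v_L[OF 2(1)] new_K LK 2(3) by auto
        moreover have "new r ` T \<in> Q r" using 2 by (auto simp: Q_def)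
        then have "\<tau> \<in> Big" using 2 unfolding Big_def by blast
        ultimately show ?thesis by (auto simp: B3_def)
      qed
    qed
    \<comment> \<open>The faces of the base, with twins, that are not faces of one of the twin cross-polytopes.\<close>
    define I where "I = {\<sigma> \<in> P. star \<notin> \<sigma> \<and> (\<forall>r\<in>{1..k}. \<forall>T\<in>crosspolytope n. \<sigma> \<noteq> new r ` T)}"
    define V where "V = insert star (\<Union>K \<union> (\<Union>r\<in>{1..k}. new r ` X))"
    have finV: "finite V" using fin by (simp add: V_def X_def)
    have P_V: "\<sigma> \<subseteq> V" if \<sigma>: "\<sigma> \<in> P" for \<sigma>
    proof -
      obtain \<rho> where \<rho>: "\<rho> \<in> L" "\<sigma> \<subseteq> insert star (\<rho> \<union> N \<rho>)" using \<sigma> unfolding P_def by blast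
      have "N \<rho> \<subseteq> (\<Union>r\<in>{1..k}. new r ` X)" unfolding N_def by blast
      moreover have "\<rho> \<subseteq> \<Union>K" using \<rho>(1) LK by blast
      ultimately show ?thesis using \<rho>(2) unfolding V_def by blast
    qed
    then have finP: "finite P"
      using finV by (intro finite_subset[of P "Pow V"]) auto
    have "insert star \<tau> \<in> B3" if \<sigma>\<tau>: "\<sigma> \<in> I" "\<tau> \<in> B3" "\<sigma> \<subseteq> \<tau>" for \<sigma> \<tau>
    proof (cases "\<tau> \<in> P")
      case True
      then show ?thesis using P_star B3 by blast
    next
      case False
      then obtain r T where rT: "r \<in> {1..k}" "T \<in> crosspolytope n" "\<tau> = insert (v r) (new r ` T)"
        using \<sigma>\<tau>(2) B3 by auto
      have "v r \<notin> \<sigma>" using \<sigma>\<tau>(1) v_P[OF rT(1)] by (auto simp: I_def)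
      then have "\<sigma> \<subseteq> new r ` T" using \<sigma>\<tau>(3) rT by auto
      then obtain T' where "T' \<subseteq> T" "\<sigma> = new r ` T'" by (meson subset_image_iff)
      then have False using \<sigma>\<tau>(1) rT subset_in_crosspolytope unfolding I_def by blast
      then show ?thesis ..
    qed
    moreover have "\<sigma> \<noteq> {}" if "\<sigma> \<in> I" for \<sigma>
      using that k empty_in_crosspolytope[of n] unfolding I_def by force
    moreover have "finite \<sigma>" if "\<sigma> \<in> I" for \<sigma>
      using that P_V[of \<sigma>] finite_subset[OF _ finV] by (simp add: I_def)
    ultimately have "collapses B3 {\<tau> \<in> B3. \<forall>\<sigma>\<in>I. \<not> \<sigma> \<subseteq> \<tau>}"
      using finP by (intro collapse_cones[where w = "\<lambda>_. star"]) (auto simp: I_def)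
    with Big_B3 have "collapses Big {\<tau> \<in> B3. \<forall>\<sigma>\<in>I. \<not> \<sigma> \<subseteq> \<tau>}" by (rule rtranclp_trans)
    also have "{\<tau> \<in> B3. \<forall>\<sigma>\<in>I. \<not> \<sigma> \<subseteq> \<tau>} = ?W"
    proof (intro equalityI subsetI)
      fix \<tau> assume \<tau>: "\<tau> \<in> {\<tau> \<in> B3. \<forall>\<sigma>\<in>I. \<not> \<sigma> \<subseteq> \<tau>}"
      show "\<tau> \<in> ?W"
      proof (cases "\<tau> \<in> P")
        case True
        then have "\<tau> - {star} \<in> P" unfolding P_def by blast
        moreover have "\<tau> - {star} \<notin> I" using \<tau> by blast
        ultimately obtain r T where rT: "r \<in> {1..k}" "T \<in> crosspolytope n" "\<tau> - {star} = new r ` T"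
          unfolding I_def by blast
        then have "\<tau> = new r ` T \<or> \<tau> = insert star (new r ` T)" by blast
        then show ?thesis using rT by blast
      next
        case False
        then show ?thesis using \<tau> B3 by blast
      qed
    next
      fix \<tau> assume "\<tau> \<in> ?W"
      then obtain r T where rT: "r \<in> {1..k}" "T \<in> crosspolytope n"
        "\<tau> = new r ` T \<or> \<tau> = insert star (new r ` T) \<or> \<tau> = insert (v r) (new r ` T)" by blast
      have "new r ` T \<in> P" using QP[OF rT(1)] rT(2) by (auto simp: Q_def)
      moreover from this have "insert star (new r ` T) \<in> P" by (rule P_star)
      ultimately have "\<tau> \<in> B3" using rT unfolding B3 by blast
      moreover have "\<not> \<sigma> \<subseteq> \<tau>" if "\<sigma> \<in> I" for \<sigma>
      proof
        assume "\<sigma> \<subseteq> \<tau>"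
        moreover have "v r \<notin> \<sigma>" "star \<notin> \<sigma>" using that v_P[OF rT(1)] by (auto simp: I_def)
        ultimately have "\<sigma> \<subseteq> new r ` T" using rT(3) by auto
        then obtain T' where "T' \<subseteq> T" "\<sigma> = new r ` T'" by (meson subset_image_iff)
        then show False using that rT subset_in_crosspolytope unfolding I_def by blast
      qed
      ultimately show "\<tau> \<in> {\<tau> \<in> B3. \<forall>\<sigma>\<in>I. \<not> \<sigma> \<subseteq> \<tau>}" by blast
    qed
    finally show ?thesis unfolding bouquet_eq .
  qed
  have "geometric_realization K homotopy_equivalent_space geometric_realization K1"
    using collapses_homotopy_equivalent[OF K_K1 K] .
  also have "geometric_realization K1 homotopy_equivalent_space geometric_realization Big"
    using collapses_homotopy_equivalent[OF Big_K1 Big_closed] homotopy_equivalent_space_sym by blast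
  also have "geometric_realization Big homotopy_equivalent_space geometric_realization (bouquet k n lab)"
    using collapses_homotopy_equivalent[OF Big_bouquet Big_closed] .
  finally have "geometric_realization K homotopy_equivalent_space
    geometric_realization (bouquet k n lab)" .
  with labelling show ?thesis by blast
qed

section \<open>A bouquet of cross-polytopes is a wedge of spheres\<close>

lemma compact_space_nsphere: "compact_space (nsphere n)"
proof -
  let ?S = "{x :: nat \<Rightarrow> real. (\<Sum>i\<le>n. x i ^ 2) = 1 \<and> (\<forall>i>n. x i = 0)}"
  have "x i \<in> {-1..1}" if "x \<in> ?S" for x i
  proof (cases "i \<le> n")
    case True
    then have "x i ^ 2 \<le> (\<Sum>i\<le>n. x i ^ 2)" by (intro member_le_sum) auto
    then have "\<bar>x i\<bar> \<le> 1" using that by (simp add: abs_square_le_1)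
    then show ?thesis by auto
  qed (use that in auto)
  then have "?S \<subseteq> (\<Pi>\<^sub>E i\<in>UNIV. {-1..1})" by auto
  moreover have "compactin (powertop_real UNIV) (\<Pi>\<^sub>E i\<in>UNIV. {-1..1})"
    by (subst compactin_PiE) auto
  moreover have "closed ?S"
    by (intro closed_Collect_conj closed_Collect_all closed_Collect_imp closed_Collect_eq
        continuous_intros continuous_on_product_coordinates) auto
  then have "closedin (powertop_real UNIV) ?S"
    by (simp add: euclidean_product_topology)
  ultimately have "compactin (powertop_real UNIV) ?S"
    using closed_compactin by blast
  then show ?thesis
    unfolding nsphere by (rule compact_space_subtopology)
qed

lemma compact_space_sum_topology:
  assumes "finite I" "\<And>i. i \<in> I \<Longrightarrow> compact_space (X i)"
  shows "compact_space (sum_topology X I)"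
proof -
  have "compactin (sum_topology X I) (Pair i ` topspace (X i))" if "i \<in> I" for i
    using assms(2)[OF that] continuous_map_component_injection[OF that]
    by (intro image_compactin) (auto simp: compact_space_def)
  then have "compactin (sum_topology X I) (\<Union>i\<in>I. Pair i ` topspace (X i))"
    using assms(1) by (intro compactin_Union) auto
  moreover have "(\<Union>i\<in>I. Pair i ` topspace (X i)) = topspace (sum_topology X I)" by auto
  ultimately show ?thesis by (simp add: compact_space_def)
qed

lemma continuous_map_from_sum_topology:
  assumes "\<And>i. i \<in> I \<Longrightarrow> continuous_map (X i) Y (\<lambda>x. f (i, x))"
  shows "continuous_map (sum_topology X I) Y f"
  using assms by (fastforce simp: continuous_map_def openin_sum_topology Pi_iff)

lemma Hausdorff_geometric_realization: "Hausdorff_space (geometric_realization K)"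
  unfolding geometric_realization_def
  by (intro Hausdorff_space_subtopology) (simp add: Hausdorff_space_product_topology)

definition signed_part :: "nat \<times> bool \<Rightarrow> (nat \<Rightarrow> real) \<Rightarrow> real" where
  "signed_part z p = max 0 (if snd z then p (fst z) else - p (fst z))"

text \<open>
The barycentric coordinates of a point of the round sphere after rescaling it to the unit sphere
of the \<open>l\<^sub>1\<close> norm, where the cross-polytope is the unit sphere itself. The sum only serves
to look up the vertex \<open>z\<close> with label \<open>v\<close>.
\<close>

definition sphere_chart :: "nat \<Rightarrow> (nat \<times> bool \<Rightarrow> 'v) \<Rightarrow> (nat \<Rightarrow> real) \<Rightarrow> 'v \<Rightarrow> real" where
  "sphere_chart n l p v =
     (\<Sum>z | z \<in> {..n} \<times> UNIV \<and> l z = v. signed_part z p) / (\<Sum>j\<le>n. \<bar>p j\<bar>)"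

lemma sphere_chart_vertex:
  assumes "inj_on l ({..n} \<times> UNIV)" "z \<in> {..n} \<times> UNIV"
  shows "sphere_chart n l p (l z) = signed_part z p / (\<Sum>j\<le>n. \<bar>p j\<bar>)"
proof -
  have "{y. y \<in> {..n} \<times> UNIV \<and> l y = l z} = {z}"
    using assms by (auto dest: inj_onD)
  then show ?thesis by (simp add: sphere_chart_def)
qed

lemma sphere_chart_off: "v \<notin> l ` ({..n} \<times> UNIV) \<Longrightarrow> sphere_chart n l p v = 0"
proof -
  assume "v \<notin> l ` ({..n} \<times> UNIV)"
  then have "{z. z \<in> {..n} \<times> UNIV \<and> l z = v} = {}" by blast
  then show ?thesis unfolding sphere_chart_def by (simp only: sum.empty div_0)
qed

lemma l1_norm_pos:
  assumes "p \<in> topspace (nsphere n)"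
  shows "0 < (\<Sum>j\<le>n. \<bar>p j\<bar>)"
proof -
  have "\<exists>j\<le>n. p j \<noteq> 0"
  proof (rule ccontr)
    assume "\<not> (\<exists>j\<le>n. p j \<noteq> 0)"
    then have "(\<Sum>j\<le>n. p j ^ 2) = 0" by (intro sum.neutral) auto
    then show False using assms by (simp add: nsphere)
  qed
  then show ?thesis by (auto intro!: sum_pos2)
qed

lemma sum_signs:
  fixes f :: "nat \<times> bool \<Rightarrow> real"
  shows "(\<Sum>z\<in>{..n} \<times> UNIV. f z) = (\<Sum>j\<le>n. f (j, True) + f (j, False))"
proof -
  have "(\<Sum>z\<in>{..n} \<times> UNIV. f z) = (\<Sum>j\<le>n. \<Sum>b\<in>UNIV. f (j, b))"
    by (simp add: sum.cartesian_product)
  then show ?thesis by (simp add: UNIV_bool add.commute)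
qed

lemma sphere_chart_in:
  assumes inj: "inj_on l ({..n} \<times> UNIV)" and p: "p \<in> topspace (nsphere n)"
    and K: "\<And>T. T \<in> crosspolytope (Suc n) \<Longrightarrow> l ` T \<in> K"
  shows "sphere_chart n l p \<in> topspace (geometric_realization K)"
proof -
  let ?Z = "{..n} \<times> (UNIV :: bool set)" and ?N = "\<Sum>j\<le>n. \<bar>p j\<bar>"
  define T where "T = {z \<in> ?Z. signed_part z p \<noteq> 0}"
  have N: "0 < ?N" using l1_norm_pos[OF p] .
  have supp: "{v. sphere_chart n l p v \<noteq> 0} = l ` T"
  proof -
    have "sphere_chart n l p v \<noteq> 0 \<longleftrightarrow> v \<in> l ` T" for v
    proof (cases "v \<in> l ` ?Z")
      case True
      then obtain z where z: "z \<in> ?Z" "v = l z" by blast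
      have "l z \<in> l ` T \<longleftrightarrow> z \<in> T"
        using z(1) inj by (intro inj_on_image_mem_iff[OF inj]) (auto simp: T_def)
      then show ?thesis using sphere_chart_vertex[OF inj z(1), of p] z N by (simp add: T_def)
    next
      case False
      then show ?thesis using sphere_chart_off[OF False] by (auto simp: T_def)
    qed
    then show ?thesis by blast
  qed
  have T: "T \<in> crosspolytope (Suc n)"
    by (auto simp: T_def crosspolytope_def signed_part_def lessThan_Suc_atMost)
  have finT: "finite T" by (simp add: T_def)
  have injT: "inj_on l T" using inj by (rule inj_on_subset) (auto simp: T_def)
  have "(\<Sum>v | sphere_chart n l p v \<noteq> 0. sphere_chart n l p v) = (\<Sum>z\<in>T. sphere_chart n l p (l z))"
    unfolding supp by (simp add: sum.reindex[OF injT])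
  also have "\<dots> = (\<Sum>z\<in>T. signed_part z p / ?N)"
    by (intro sum.cong refl sphere_chart_vertex[OF inj]) (auto simp: T_def)
  also have "\<dots> = (\<Sum>z\<in>?Z. signed_part z p / ?N)"
    by (intro sum.mono_neutral_left) (auto simp: T_def)
  also have "\<dots> = (\<Sum>z\<in>?Z. signed_part z p) / ?N"
    by (simp add: sum_divide_distrib)
  also have "(\<Sum>z\<in>?Z. signed_part z p) = ?N"
    unfolding sum_signs by (intro sum.cong) (auto simp: signed_part_def)
  finally have "(\<Sum>v | sphere_chart n l p v \<noteq> 0. sphere_chart n l p v) = 1" using N by simp
  moreover have "0 \<le> sphere_chart n l p v" for v
    unfolding sphere_chart_def using N by (intro divide_nonneg_pos sum_nonneg) (auto simp: signed_part_def)
  ultimately show ?thesis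
    using K[OF T] finT by (simp add: topspace_geometric_realization supp)
qed

lemma continuous_sphere_chart:
  assumes inj: "inj_on l ({..n} \<times> UNIV)"
    and K: "\<And>T. T \<in> crosspolytope (Suc n) \<Longrightarrow> l ` T \<in> K"
  shows "continuous_map (nsphere n) (geometric_realization K) (sphere_chart n l)"
proof -
  have pos: "continuous_map (nsphere n) euclideanreal (signed_part z)" for z
    unfolding signed_part_def
    by (cases "snd z") (auto intro!: continuous_intros continuous_map_nsphere_projection)
  have "continuous_map (nsphere n) euclideanreal (\<lambda>p. sphere_chart n l p v)" for v
    unfolding sphere_chart_def
    by (intro continuous_map_real_divide continuous_map_sum continuous_map_real_abs
        continuous_map_nsphere_projection pos) (use l1_norm_pos in force)+
  then show ?thesis
    using sphere_chart_in[OF inj _ K] by (auto simp: continuous_map_into_realization)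
qed

text \<open>
Equal charts mean that the two points are positive multiples of each other, and both have
Euclidean norm \<open>1\<close>.
\<close>

lemma sphere_chart_inject:
  assumes inj: "inj_on l ({..n} \<times> UNIV)"
    and p: "p \<in> topspace (nsphere n)" and q: "q \<in> topspace (nsphere n)"
    and eq: "sphere_chart n l p = sphere_chart n l q"
  shows "p = q"
proof -
  let ?N = "\<lambda>p. \<Sum>j\<le>n. \<bar>p j :: real\<bar>"
  have N: "0 < ?N p" "0 < ?N q" using l1_norm_pos p q by auto
  define c where "c = ?N p / ?N q"
  have c: "0 < c" using N by (simp add: c_def)
  have pq: "p j = c * q j" if "j \<le> n" for j
  proof -
    have "signed_part (j, b) p / ?N p = signed_part (j, b) q / ?N q" for b
      using sphere_chart_vertex[OF inj, of "(j, b)"] that eq by (metis SigmaI UNIV_I atMost_iff)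
    then have "signed_part (j, b) p = c * signed_part (j, b) q" for b
      using N by (simp add: c_def field_simps)
    moreover have "x j = signed_part (j, True) x - signed_part (j, False) x" for x
      by (auto simp: signed_part_def)
    ultimately show ?thesis by (metis right_diff_distrib)
  qed
  have "1 = (\<Sum>j\<le>n. (p j)\<^sup>2)" using p by (simp add: nsphere)
  also have "\<dots> = (\<Sum>j\<le>n. c\<^sup>2 * (q j)\<^sup>2)"
    by (intro sum.cong) (auto simp: pq power_mult_distrib)
  also have "\<dots> = c\<^sup>2" using q by (simp add: nsphere flip: sum_distrib_left)
  finally have "c = 1" using c by (simp add: power2_eq_1_iff)
  show ?thesis
  proof
    fix j
    show "p j = q j"
      using pq[of j] \<open>c = 1\<close> p q by (cases "j \<le> n") (auto simp: nsphere)
  qed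
qed

text \<open>
Since a face contains at most one of two opposite vertices, the differences of opposite coordinates
have \<open>l\<^sub>1\<close> norm \<open>1\<close> and determine the point. Rescaling them to Euclidean norm \<open>1\<close> gives the
preimage.
\<close>

lemma sphere_chart_surjective:
  assumes inj: "inj_on l ({..n} \<times> UNIV)" and T: "T \<in> crosspolytope (Suc n)"
    and x: "\<And>v. 0 \<le> x v" "{v. x v \<noteq> 0} = l ` T" "(\<Sum>v | x v \<noteq> 0. x v) = 1"
  shows "\<exists>p \<in> topspace (nsphere n). sphere_chart n l p = x"
proof -
  let ?Z = "{..n} \<times> (UNIV :: bool set)"
  have TZ: "T \<subseteq> ?Z" using T by (auto simp: crosspolytope_def)
  have off: "x (l z) = 0" if "z \<in> ?Z" "z \<notin> T" for z
  proof -
    have "l z \<notin> l ` T" using that inj TZ by (simp add: inj_on_image_mem_iff)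
    then show ?thesis using x(2) by blast
  qed
  have antipodes: "x (l (j, True)) = 0 \<or> x (l (j, False)) = 0" if "j \<le> n" for j
    using off[of "(j, True)"] off[of "(j, False)"] T that by (auto simp: crosspolytope_def)
  define q where "q j = (if j \<le> n then x (l (j, True)) - x (l (j, False)) else 0)" for j
  have q_part: "signed_part z q = x (l z)" if "z \<in> ?Z" for z
    using antipodes[of "fst z"] that x(1)[of "l z"] x(1)[of "l (fst z, \<not> snd z)"]
    by (cases z; cases "snd z") (auto simp: signed_part_def q_def)
  have "(\<Sum>j\<le>n. \<bar>q j\<bar>) = (\<Sum>z\<in>?Z. signed_part z q)"
    unfolding sum_signs by (intro sum.cong) (auto simp: signed_part_def)
  also have "\<dots> = (\<Sum>z\<in>?Z. x (l z))" by (intro sum.cong refl q_part)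
  also have "\<dots> = (\<Sum>z\<in>T. x (l z))"
    using off TZ by (intro sum.mono_neutral_right) auto
  also have "\<dots> = (\<Sum>v\<in>l ` T. x v)"
    using inj_on_subset[OF inj TZ] by (simp add: sum.reindex)
  also have "\<dots> = 1" using x(2,3) by simp
  finally have q1: "(\<Sum>j\<le>n. \<bar>q j\<bar>) = 1" .
  define e where "e = sqrt (\<Sum>j\<le>n. (q j)\<^sup>2)"
  have "(\<Sum>j\<le>n. (q j)\<^sup>2) \<noteq> 0"
  proof
    assume "(\<Sum>j\<le>n. (q j)\<^sup>2) = 0"
    then have "\<forall>j\<in>{..n}. (q j)\<^sup>2 = 0" by (subst (asm) sum_nonneg_eq_0_iff) auto
    then show False using q1 by simp
  qed
  then have e: "0 < e" "e\<^sup>2 = (\<Sum>j\<le>n. (q j)\<^sup>2)"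
    by (auto simp: e_def sum_nonneg less_le)
  define p where "p j = q j / e" for j
  have "(\<Sum>j\<le>n. (p j)\<^sup>2) = 1"
    using e(1) by (simp add: p_def power_divide e(2)[symmetric] flip: sum_divide_distrib)
  then have p: "p \<in> topspace (nsphere n)"
    by (auto simp: nsphere p_def q_def)
  have N: "(\<Sum>j\<le>n. \<bar>p j\<bar>) = 1 / e"
    using e q1 by (simp add: p_def flip: sum_divide_distrib)
  have "sphere_chart n l p v = x v" for v
  proof (cases "v \<in> l ` ?Z")
    case True
    then obtain z where z: "z \<in> ?Z" "v = l z" by blast
    have "signed_part z p = signed_part z q / e"
      using e by (auto simp: signed_part_def p_def max_def field_simps)
    then show ?thesis
      using sphere_chart_vertex[OF inj z(1), of p] q_part[OF z(1)] z(2) e by (simp add: N)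
  next
    case False
    then have "v \<notin> l ` T" using TZ by blast
    then show ?thesis using x(2) sphere_chart_off[OF False] by auto
  qed
  then show ?thesis using p by blast
qed

lemma signed_part_nonzero_imp_basepoint:
  assumes p: "p \<in> topspace (nsphere n)"
    and "\<And>z. z \<in> {..n} \<times> UNIV \<Longrightarrow> signed_part z p \<noteq> 0 \<Longrightarrow> z = (0, True)"
  shows "p = nsphere_basepoint"
proof -
  have zero: "p j = 0" if "0 < j" for j
  proof (cases "j \<le> n")
    case True
    then have "signed_part (j, True) p = 0" "signed_part (j, False) p = 0"
      using assms(2)[of "(j, True)"] assms(2)[of "(j, False)"] that by auto
    then show ?thesis by (simp add: signed_part_def max_def split: if_splits)
  next
    case False
    then show ?thesis using p by (simp add: nsphere)
  qed
  have "(\<Sum>j\<le>n. (p j)\<^sup>2) = (\<Sum>j\<in>{0}. (p j)\<^sup>2)"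
    using zero by (intro sum.mono_neutral_right) auto
  then have "(p 0)\<^sup>2 = 1" using p by (simp add: nsphere)
  moreover have "signed_part (0, False) p = 0" using assms(2)[of "(0, False)"] by auto
  then have "0 \<le> p 0" by (simp add: signed_part_def max_def split: if_splits)
  ultimately have "p 0 = 1" by (simp add: power2_eq_1_iff)
  then show ?thesis using zero by (auto simp: nsphere_basepoint_def)
qed

lemma bouquet_chart_continuous:
  assumes "bouquet_labelling k n lab" "r \<in> {1..k}"
  shows "continuous_map (nsphere n) (geometric_realization (bouquet k n lab)) (sphere_chart n (lab r))"
  using assms(2) by (intro continuous_sphere_chart bouquet_labelling_inj[OF assms])
    (unfold bouquet_def, blast)

lemma bouquet_chart_surjective:
  assumes lab: "bouquet_labelling k n lab" and x: "x \<in> topspace (geometric_realization (bouquet k n lab))"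
  shows "\<exists>r\<in>{1..k}. \<exists>p\<in>topspace (nsphere n). sphere_chart n (lab r) p = x"
proof -
  obtain r T where r: "r \<in> {1..k}" "T \<in> crosspolytope (Suc n)" "{v. x v \<noteq> 0} = lab r ` T"
    using x by (auto simp: topspace_geometric_realization bouquet_def)
  have "inj_on (lab r) ({..n} \<times> UNIV)" using bouquet_labelling_inj[OF lab r(1)] .
  then show ?thesis
    using sphere_chart_surjective[OF _ r(2) _ r(3)] x r(1) by (auto simp: topspace_geometric_realization)
qed

text \<open>
Points in different copies can agree only if their support is the shared vertex, which is the image
of the base point. So the charts make exactly the identifications of the wedge.
\<close>

lemma bouquet_chart_eq_iff:
  assumes lab: "bouquet_labelling k n lab" and r: "r \<in> {1..k}" and s: "s \<in> {1..k}"
    and p: "p \<in> topspace (nsphere n)" and q: "q \<in> topspace (nsphere n)"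
  shows "sphere_chart n (lab r) p = sphere_chart n (lab s) q \<longleftrightarrow>
           r = s \<and> p = q \<or> p = nsphere_basepoint \<and> q = nsphere_basepoint"
proof
  note inj = bouquet_labelling_inj[OF lab]
  have base: "p = nsphere_basepoint"
    if r: "r \<in> {1..k}" and s: "s \<in> {1..k}" and "r \<noteq> s" and p: "p \<in> topspace (nsphere n)"
      and eq: "sphere_chart n (lab r) p = sphere_chart n (lab s) q" for r s p q
  proof (rule signed_part_nonzero_imp_basepoint[OF p])
    fix z :: "nat \<times> bool"
    assume z: "z \<in> {..n} \<times> UNIV" "signed_part z p \<noteq> 0"
    then have "sphere_chart n (lab r) p (lab r z) \<noteq> 0"
      using sphere_chart_vertex[OF inj[OF r] z(1), of p] l1_norm_pos[OF p] by simp
    then have "sphere_chart n (lab s) q (lab r z) \<noteq> 0" by (simp add: eq)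
    then have "lab r z \<in> lab s ` ({..n} \<times> UNIV)" using sphere_chart_off by metis
    then obtain y where "y \<in> {..n} \<times> UNIV" "lab r z = lab s y" by blast
    then show "z = (0, True)" using bouquet_labelling_disjoint[OF lab r s \<open>r \<noteq> s\<close> z(1)] by blast
  qed
  {
    assume eq: "sphere_chart n (lab r) p = sphere_chart n (lab s) q"
    show "r = s \<and> p = q \<or> p = nsphere_basepoint \<and> q = nsphere_basepoint"
    proof (cases "r = s")
      case True
      then show ?thesis using sphere_chart_inject[OF inj[OF r] p q] eq by simp
    next
      case False
      then show ?thesis using base[OF r s False p eq] base[OF s r _ q eq[symmetric]] by simp
    qed
  next
    have chart: "sphere_chart n (lab r) nsphere_basepoint = (\<lambda>v. if v = lab r (0, True) then 1 else 0)"
      if r: "r \<in> {1..k}" for r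
    proof
      fix v
      have N: "(\<Sum>j\<le>n. \<bar>nsphere_basepoint j\<bar>) = 1"
        by (simp add: nsphere_basepoint_def if_distrib[of abs] cong: if_cong)
      show "sphere_chart n (lab r) nsphere_basepoint v = (if v = lab r (0, True) then 1 else 0)"
      proof (cases "v \<in> lab r ` ({..n} \<times> UNIV)")
        case True
        then obtain z where z: "z \<in> {..n} \<times> UNIV" "v = lab r z" by blast
        have "lab r z = lab r (0, True) \<longleftrightarrow> z = (0, True)"
          using inj_on_eq_iff[OF inj[OF r] z(1)] by simp
        moreover have "signed_part z nsphere_basepoint = (if z = (0, True) then 1 else 0)"
          by (cases z) (auto simp: signed_part_def nsphere_basepoint_def)
        ultimately show ?thesis using sphere_chart_vertex[OF inj[OF r] z(1)] z(2) by (simp add: N)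
      next
        case False
        then have "v \<noteq> lab r (0, True)" by auto
        then show ?thesis using sphere_chart_off[OF False] by simp
      qed
    qed
    assume "r = s \<and> p = q \<or> p = nsphere_basepoint \<and> q = nsphere_basepoint"
    then show "sphere_chart n (lab r) p = sphere_chart n (lab s) q"
      using chart[OF r] chart[OF s] bouquet_labelling_basepoint[OF lab r s] by auto
  }
qed

text \<open>
The charts together induce a continuous bijection from the compact wedge to a Hausdorff space.
\<close>

lemma bouquet_homeomorphic_wedge_of_spheres:
  assumes lab: "bouquet_labelling k n lab"
  shows "wedge_of_spheres k n homeomorphic_space geometric_realization (bouquet k n lab)"
proof -
  let ?X = "sum_topology (\<lambda>_. nsphere n) {1..k}" and ?Y = "geometric_realization (bouquet k n lab)"
  let ?R = "wedge_rel {1..k} (\<lambda>_. nsphere n) (\<lambda>_. nsphere_basepoint)"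
  define f where "f = (\<lambda>(r, p). sphere_chart n (lab r) p)"
  have f_eq: "f x = f y \<longleftrightarrow> (x, y) \<in> ?R" if "x \<in> topspace ?X" "y \<in> topspace ?X" for x y
    using that bouquet_chart_eq_iff[OF lab]
    by (auto simp: f_def wedge_rel_def split: prod.splits)
  have equiv: "equiv (topspace ?X) ?R"
    by (intro equiv_wedge_rel nsphere_basepoint_in)
  have f_cont: "continuous_map ?X ?Y f"
    using bouquet_chart_continuous[OF lab] by (intro continuous_map_from_sum_topology) (simp add: f_def)
  have f_onto: "f ` topspace ?X = topspace ?Y"
  proof
    show "f ` topspace ?X \<subseteq> topspace ?Y"
      using continuous_map_image_subset_topspace[OF f_cont] .
    show "topspace ?Y \<subseteq> f ` topspace ?X"
      using bouquet_chart_surjective[OF lab] by (force simp: f_def)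
  qed
  have quot: "quotient_map ?X (wedge_of_spheres k n) (\<lambda>x. ?R `` {x})"
    unfolding wedge_of_spheres_def wedge_sum_def by (rule quotient_map_quotient_space)
  have class_eq: "?R `` {x} = ?R `` {y} \<longleftrightarrow> f x = f y" if "x \<in> topspace ?X" "y \<in> topspace ?X" for x y
    using f_eq[OF that] eq_equiv_class_iff[OF equiv that] by simp
  then have respects: "f x = f y"
    if "x \<in> topspace ?X" "y \<in> topspace ?X" "?R `` {x} = ?R `` {y}" for x y
    using that by blast
  obtain g where g: "continuous_map (wedge_of_spheres k n) ?Y g"
      "g ` topspace (wedge_of_spheres k n) = f ` topspace ?X"
      "\<And>x. x \<in> topspace ?X \<Longrightarrow> g (?R `` {x}) = f x"
    by (rule quotient_map_lift_exists[OF quot f_cont]) (rule respects, assumption+, rule that)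
  have top: "topspace (wedge_of_spheres k n) = (\<lambda>x. ?R `` {x}) ` topspace ?X"
    using quotient_imp_surjective_map[OF quot] by simp
  have "inj_on g (topspace (wedge_of_spheres k n))"
    unfolding top using g(3) class_eq by (auto simp: inj_on_def)
  moreover have "compact_space (wedge_of_spheres k n)"
  proof -
    have "compact_space ?X" by (simp add: compact_space_sum_topology compact_space_nsphere)
    then have "compactin (wedge_of_spheres k n) ((\<lambda>x. ?R `` {x}) ` topspace ?X)"
      unfolding compact_space_def by (rule image_compactin[OF _ quotient_imp_continuous_map[OF quot]])
    then show ?thesis by (simp only: top compact_space_def)
  qed
  ultimately have "homeomorphic_map (wedge_of_spheres k n) ?Y g"
    using g f_onto by (intro continuous_imp_homeomorphic_map Hausdorff_geometric_realization) auto
  then show ?thesis by (rule homeomorphic_map_imp_homeomorphic_space)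
qed

lemma bouquet_homeomorphic_sphere:
  assumes lab: "bouquet_labelling 1 n lab"
  shows "nsphere n homeomorphic_space geometric_realization (bouquet 1 n lab)"
proof -
  let ?Y = "geometric_realization (bouquet 1 n lab)" and ?f = "sphere_chart n (lab 1)"
  have cont: "continuous_map (nsphere n) ?Y ?f"
    using bouquet_chart_continuous[OF lab] by simp
  moreover have "?f ` topspace (nsphere n) = topspace ?Y"
    using bouquet_chart_surjective[OF lab] continuous_map_image_subset_topspace[OF cont] by fastforce
  moreover have "inj_on ?f (topspace (nsphere n))"
    using sphere_chart_inject[OF bouquet_labelling_inj[OF lab]] by (auto intro: inj_onI)
  ultimately have "homeomorphic_map (nsphere n) ?Y ?f"
    by (intro continuous_imp_homeomorphic_map compact_space_nsphere Hausdorff_geometric_realization)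
  then show ?thesis by (rule homeomorphic_map_imp_homeomorphic_space)
qed

section \<open>Staircase graphs\<close>

lemma subset_closed_independence_complex: "subset_closed (independence_complex V E)"
  unfolding subset_closed_def using independence_complex_subset by blast

lemma finite_independence_complex: "finite V \<Longrightarrow> finite (\<Union>(independence_complex V E))"
  by (rule finite_subset[of _ V]) (auto simp: independence_complex_def)

lemma link_vertex_independence_complex:
  assumes "v \<in> V" "{v} \<notin> E"
  shows "link (independence_complex V E) {v} = independence_complex {u \<in> V. u \<noteq> v \<and> {u, v} \<notin> E} E"
  using assms by (auto simp: link_def independence_complex_def insert_commute)

lemma delete_vertex_independence_complex:
  "delete_star (independence_complex V E) {v} = independence_complex (V - {v}) E"
  by (auto simp: delete_star_def independence_complex_def)

lemma link_edge_independence_complex: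
  assumes "u \<in> V" "v \<in> V" "{u} \<notin> E" "{v} \<notin> E" "{u, v} \<notin> E"
  shows "link (independence_complex V E) {u, v} =
    independence_complex {w \<in> V. w \<noteq> u \<and> w \<noteq> v \<and> {w, u} \<notin> E \<and> {w, v} \<notin> E} E"
  using assms by (auto simp: link_def independence_complex_def insert_commute)

lemma delete_edge_independence_complex:
  assumes "u \<noteq> v"
  shows "delete_star (independence_complex V E) {u, v} = independence_complex V (insert {u, v} E)"
  using assms by (auto simp: delete_star_def independence_complex_def doubleton_eq_iff)

text \<open>
A face that contains \<open>x\<close> contains no neighbour of \<open>x\<close>, hence no neighbour of \<open>u\<close>, so \<open>u\<close> can be added to it.
If \<open>u\<close> and \<open>x\<close> are adjacent, the case \<open>y = x\<close> of the hypothesis puts a loop at \<open>x\<close>, which then lies in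
no face.
\<close>

lemma collapse_dominated:
  assumes "finite X" "X \<subseteq> V" "u \<in> V - X" "{u} \<notin> E"
    and dom: "\<And>x y. x \<in> X \<Longrightarrow> y \<in> V \<Longrightarrow> {u, y} \<in> E \<Longrightarrow> {x, y} \<in> E"
  shows "collapses (independence_complex V E) (independence_complex (V - X) E)"
proof -
  let ?K = "independence_complex V E"
  have "insert u \<tau> \<in> ?K" if x: "x \<in> X" and \<tau>: "\<tau> \<in> ?K" "{x} \<subseteq> \<tau>" for x \<tau>
  proof -
    have "{u, y} \<notin> E" if "y \<in> \<tau>" for y
      using dom[OF x, of y] that \<tau> by (auto simp: independence_complex_def)
    then show ?thesis using \<tau>(1) assms(3,4) by (auto simp: independence_complex_def insert_commute)
  qed
  then have "collapses ?K {\<tau> \<in> ?K. \<forall>x\<in>X. \<not> {x} \<subseteq> \<tau>}"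
    using assms(1,3) by (intro collapse_cones[where w = "\<lambda>_. u"]) auto
  also have "{\<tau> \<in> ?K. \<forall>x\<in>X. \<not> {x} \<subseteq> \<tau>} = independence_complex (V - X) E"
    by (auto simp: independence_complex_def)
  finally show ?thesis .
qed

lemma isolated_vertex_collapsible:
  assumes "finite V" "u \<in> V" "\<And>y. y \<in> V \<Longrightarrow> {u, y} \<notin> E"
  shows "collapsible (independence_complex V E)"
proof (rule cone_collapsible)
  have u: "{u} \<notin> E" using assms(3)[OF assms(2)] by simp
  show "{u} \<in> independence_complex V E" using assms by (force simp: independence_complex_def)
  show "insert u \<tau> \<in> independence_complex V E" if "\<tau> \<in> independence_complex V E" for \<tau>
    using that assms u by (auto simp: independence_complex_def insert_commute subset_iff)
qed (simp_all add: assms(1) finite_independence_complex subset_closed_independence_complex)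

text \<open>
The bipartite graph whose adjacency matrix is a band along the diagonal. Restricting the index sets to
\<open>{i..<n}\<close> and \<open>{j..<n'}\<close> cuts a staircase out of the band.
\<close>

definition staircase ::
  "'v set set \<Rightarrow> nat \<Rightarrow> (nat \<Rightarrow> 'v) \<Rightarrow> (nat \<Rightarrow> 'v) \<Rightarrow> nat set \<Rightarrow> nat set \<Rightarrow> bool" where
  "staircase E d a b X Y \<longleftrightarrow>
     (\<forall>x\<in>X. \<forall>y\<in>Y. {a x, b y} \<in> E \<longleftrightarrow> x \<le> y \<and> y < x + d) \<and>
     (\<forall>x\<in>X. \<forall>x'\<in>X. {a x, a x'} \<notin> E) \<and> (\<forall>y\<in>Y. \<forall>y'\<in>Y. {b y, b y'} \<notin> E) \<and>
     inj_on a X \<and> inj_on b Y \<and> a ` X \<inter> b ` Y = {}"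

lemma staircase_edge:
  "staircase E d a b X Y \<Longrightarrow> x \<in> X \<Longrightarrow> y \<in> Y \<Longrightarrow> {a x, b y} \<in> E \<longleftrightarrow> x \<le> y \<and> y < x + d"
  "staircase E d a b X Y \<Longrightarrow> x \<in> X \<Longrightarrow> y \<in> Y \<Longrightarrow> {b y, a x} \<in> E \<longleftrightarrow> x \<le> y \<and> y < x + d"
  "staircase E d a b X Y \<Longrightarrow> x \<in> X \<Longrightarrow> x' \<in> X \<Longrightarrow> {a x, a x'} \<notin> E"
  "staircase E d a b X Y \<Longrightarrow> y \<in> Y \<Longrightarrow> y' \<in> Y \<Longrightarrow> {b y, b y'} \<notin> E"
  by (simp_all add: staircase_def insert_commute)

lemma staircase_diff_a:
  assumes "staircase E d a b X Y" "P \<subseteq> X" "Q \<subseteq> Y" "R \<subseteq> P"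
  shows "a ` P \<union> b ` Q - a ` R = a ` (P - R) \<union> b ` Q"
proof -
  have "inj_on a P"
    using assms(1,2) inj_on_subset[of a X P] by (simp add: staircase_def)
  moreover have "a ` X \<inter> b ` Y = {}" using assms(1) by (simp add: staircase_def)
  then have "a ` R \<inter> b ` Q = {}" using assms(2-4) by blast
  ultimately show ?thesis using assms(4) by (auto simp: inj_on_image_set_diff[of a P P R])
qed

lemma staircase_diff_b:
  assumes "staircase E d a b X Y" "P \<subseteq> X" "Q \<subseteq> Y" "R \<subseteq> Q"
  shows "a ` P \<union> b ` Q - b ` R = a ` P \<union> b ` (Q - R)"
proof -
  have "inj_on b Q"
    using assms(1,3) inj_on_subset[of b Y Q] by (simp add: staircase_def)
  moreover have "a ` X \<inter> b ` Y = {}" using assms(1) by (simp add: staircase_def)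
  then have "b ` R \<inter> a ` P = {}" using assms(2-4) by blast
  ultimately show ?thesis using assms(4) by (auto simp: inj_on_image_set_diff[of b Q Q R])
qed

lemma staircase_fold_a:
  assumes st: "staircase E d a b X Y" and P: "P \<subseteq> X" and Q: "Q \<subseteq> Y" and R: "finite R" "R \<subseteq> P"
    and x: "x \<in> P - R"
    and dom: "\<And>x' y. x' \<in> R \<Longrightarrow> y \<in> Q \<Longrightarrow> x \<le> y \<Longrightarrow> y < x + d \<Longrightarrow> x' \<le> y \<and> y < x' + d"
  shows "collapses (independence_complex (a ` P \<union> b ` Q) E) (independence_complex (a ` (P - R) \<union> b ` Q) E)"
proof -
  have "collapses (independence_complex (a ` P \<union> b ` Q) E) (independence_complex (a ` P \<union> b ` Q - a ` R) E)"
  proof (rule collapse_dominated[where u = "a x"])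
    have "a x \<in> a ` (P - R) \<union> b ` Q" using x by blast
    then show "a x \<in> a ` P \<union> b ` Q - a ` R" using staircase_diff_a[OF st P Q R(2)] by simp
    show "{a x} \<notin> E" using staircase_edge(3)[OF st, of x x] x P by auto
    fix v w assume "v \<in> a ` R" "w \<in> a ` P \<union> b ` Q" "{a x, w} \<in> E"
    then obtain x' where x': "x' \<in> R" "v = a x'" by blast
    have in_X: "x \<in> X" "x' \<in> X" using x x' P R by auto
    have "w \<notin> a ` P" using \<open>{a x, w} \<in> E\<close> staircase_edge(3)[OF st in_X(1)] P by blast
    then obtain y where y: "y \<in> Q" "w = b y" using \<open>w \<in> _\<close> by blast
    then have "x \<le> y \<and> y < x + d"
      using \<open>{a x, w} \<in> E\<close> staircase_edge(1)[OF st in_X(1)] Q by blast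
    then show "{v, w} \<in> E"
      using dom[OF x'(1) y(1)] staircase_edge(1)[OF st in_X(2)] x' y Q by blast
  qed (use R in auto)
  then show ?thesis by (simp only: staircase_diff_a[OF st P Q R(2)])
qed

lemma staircase_fold_b:
  assumes st: "staircase E d a b X Y" and P: "P \<subseteq> X" and Q: "Q \<subseteq> Y" and R: "finite R" "R \<subseteq> Q"
    and y: "y \<in> Q - R"
    and dom: "\<And>y' x. y' \<in> R \<Longrightarrow> x \<in> P \<Longrightarrow> x \<le> y \<Longrightarrow> y < x + d \<Longrightarrow> x \<le> y' \<and> y' < x + d"
  shows "collapses (independence_complex (a ` P \<union> b ` Q) E) (independence_complex (a ` P \<union> b ` (Q - R)) E)"
proof -
  have "collapses (independence_complex (a ` P \<union> b ` Q) E) (independence_complex (a ` P \<union> b ` Q - b ` R) E)"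
  proof (rule collapse_dominated[where u = "b y"])
    have "b y \<in> a ` P \<union> b ` (Q - R)" using y by blast
    then show "b y \<in> a ` P \<union> b ` Q - b ` R" using staircase_diff_b[OF st P Q R(2)] by simp
    show "{b y} \<notin> E" using staircase_edge(4)[OF st, of y y] y Q by auto
    fix v w assume "v \<in> b ` R" "w \<in> a ` P \<union> b ` Q" "{b y, w} \<in> E"
    then obtain y' where y': "y' \<in> R" "v = b y'" by blast
    have in_Y: "y \<in> Y" "y' \<in> Y" using y y' Q R by auto
    have "w \<notin> b ` Q" using \<open>{b y, w} \<in> E\<close> staircase_edge(4)[OF st in_Y(1)] Q by blast
    then obtain x where x: "x \<in> P" "w = a x" using \<open>w \<in> _\<close> by blast
    then have "x \<le> y \<and> y < x + d"
      using \<open>{b y, w} \<in> E\<close> staircase_edge(2)[OF st _ in_Y(1)] P by blast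
    then show "{v, w} \<in> E"
      using dom[OF y'(1) x(1)] staircase_edge(2)[OF st _ in_Y(2)] x y' P by blast
  qed (use R in auto)
  then show ?thesis by (simp only: staircase_diff_b[OF st P Q R(2)])
qed

text \<open>
The least remaining indices \<open>(i, j)\<close> of the two sides after \<open>l\<close> edges have been split off. The next edge is
\<open>{a i, b j}\<close>: the vertices \<open>b y\<close> with \<open>j < y < i + d\<close> are dominated by \<open>b j\<close>, and then the vertices
\<open>a x\<close> with \<open>i < x \<le> j\<close> are dominated by \<open>a i\<close>.
\<close>

primrec stair :: "nat \<Rightarrow> nat \<times> nat \<Rightarrow> nat \<Rightarrow> nat \<times> nat" where
  "stair d p 0 = p"
| "stair d p (Suc l) = (Suc (snd (stair d p l)), fst (stair d p l) + d)"

lemma stair_even: "stair d (i, j) (2 * l) = (i + l * (d + 1), j + l * (d + 1))"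
  by (induction l) auto

lemma stair_odd: "stair d (i, j) (Suc (2 * l)) = (Suc j + l * (d + 1), i + d + l * (d + 1))"
  by (simp add: stair_even)

context
  fixes d i j :: nat
  assumes start: "i \<le> j" "j < i + d"
begin

abbreviation "stair_a l \<equiv> fst (stair d (i, j) l)"
abbreviation "stair_b l \<equiv> snd (stair d (i, j) l)"

lemma stair_bounds: "stair_a l \<le> stair_b l" "stair_b l < stair_a l + d"
  by (induction l) (use start in auto)

lemma strict_mono_stair: "strict_mono stair_a" "strict_mono stair_b"
  using stair_bounds by (auto simp: strict_mono_Suc_iff le_imp_less_Suc)

lemma stair_mono: "l \<le> k \<Longrightarrow> stair_a l \<le> stair_a k" "l \<le> k \<Longrightarrow> stair_b l \<le> stair_b k"
  using strict_mono_less_eq[OF strict_mono_stair(1)] strict_mono_less_eq[OF strict_mono_stair(2)]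
  by blast+

lemma stair_gap_a: "l < k \<Longrightarrow> stair_b l < stair_a k"
  using stair_mono(1)[of "Suc l" k] by simp

lemma stair_gap_b: "l < k \<Longrightarrow> stair_a l + d \<le> stair_b k"
  using stair_mono(2)[of "Suc l" k] by simp

lemma stair_adjacent_iff: "stair_a l \<le> stair_b k \<and> stair_b k < stair_a l + d \<longleftrightarrow> l = k"
  using stair_bounds[of k] stair_gap_a[of k l] stair_gap_b[of l k] by (cases l k rule: linorder_cases) auto

lemma stair_in_range:
  assumes "0 < k \<longrightarrow> stair_a (k - 1) < n \<and> stair_b (k - 1) < n'" and "l < k"
  shows "i \<le> stair_a l" "j \<le> stair_b l" "stair_a l < n" "stair_b l < n'"
proof -
  have "stair_a (k - 1) < n" "stair_b (k - 1) < n'" "l \<le> k - 1" using assms by auto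
  then show "i \<le> stair_a l" "j \<le> stair_b l" "stair_a l < n" "stair_b l < n'"
    using stair_mono[of 0 l] stair_mono[of l "k - 1"] by auto
qed

text \<open>
The edges that were split off earlier do not interfere: by the gap lemmas their ends are adjacent to none
of the remaining vertices.
\<close>

lemma staircase_peel:
  assumes st: "staircase E d a b {i..<n} {j..<n'}"
    and k: "0 < k \<longrightarrow> stair_a (k - 1) < n \<and> stair_b (k - 1) < n'"
  shows "collapses (independence_complex (a ` {i..<n} \<union> b ` {j..<n'}) E)
    (independence_complex (a ` (stair_a ` {..<k} \<union> {stair_a k..<n}) \<union> b ` (stair_b ` {..<k} \<union> {stair_b k..<n'})) E)"
  using k
proof (induction k)
  case (Suc k)
  let ?A = "\<lambda>k. stair_a ` {..<k} \<union> {stair_a k..<n}" and ?B = "\<lambda>k. stair_b ` {..<k} \<union> {stair_b k..<n'}"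
  have lt: "stair_a k < n" "stair_b k < n'" using Suc.prems by auto
  have before: "0 < k \<longrightarrow> stair_a (k - 1) < n \<and> stair_b (k - 1) < n'"
    using lt stair_mono[of "k - 1" k] by simp
  have A: "?A k \<subseteq> {i..<n}" and B: "?B k \<subseteq> {j..<n'}"
    using stair_in_range[OF before] stair_mono[of 0 k] by auto
  have B_eq: "?B k - {Suc (stair_b k)..<min n' (stair_a k + d)} = ?B (Suc k)"
  proof -
    have "stair_b l \<le> stair_b k" if "l < k" for l using stair_mono(2)[of l k] that by simp
    then have "stair_b ` {..<k} \<inter> {Suc (stair_b k)..<min n' (stair_a k + d)} = {}" by fastforce
    then show ?thesis using lt stair_bounds[of k] by (auto simp: lessThan_Suc)
  qed
  have A_eq: "?A k - {Suc (stair_a k)..<min n (Suc (stair_b k))} = ?A (Suc k)"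
  proof -
    have "stair_a l \<le> stair_a k" if "l < k" for l using stair_mono(1)[of l k] that by simp
    then have "stair_a ` {..<k} \<inter> {Suc (stair_a k)..<min n (Suc (stair_b k))} = {}" by fastforce
    then show ?thesis using lt stair_bounds[of k] by (auto simp: lessThan_Suc)
  qed
  let ?I = "\<lambda>P Q. independence_complex (a ` P \<union> b ` Q) E"
  have "collapses (?I (?A k) (?B k)) (?I (?A k) (?B k - {Suc (stair_b k)..<min n' (stair_a k + d)}))"
  proof (rule staircase_fold_b[OF st A B, where y = "stair_b k"])
    fix y' x assume *: "y' \<in> {Suc (stair_b k)..<min n' (stair_a k + d)}" "x \<in> ?A k" "x \<le> stair_b k" "stair_b k < x + d"
    then have "stair_a k \<le> x" using stair_gap_b[of _ k] by force
    then show "x \<le> y' \<and> y' < x + d" using * by auto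
  qed (use lt in auto)
  then have fold_b: "collapses (?I (?A k) (?B k)) (?I (?A k) (?B (Suc k)))"
    by (simp only: B_eq)
  have "collapses (?I (?A k) (?B (Suc k))) (?I (?A k - {Suc (stair_a k)..<min n (Suc (stair_b k))}) (?B (Suc k)))"
  proof (rule staircase_fold_a[OF st A, where x = "stair_a k"])
    show "?B (Suc k) \<subseteq> {j..<n'}" using B B_eq by blast
    fix x' y assume *: "x' \<in> {Suc (stair_a k)..<min n (Suc (stair_b k))}" "y \<in> ?B (Suc k)" "stair_a k \<le> y" "y < stair_a k + d"
    then have "y = stair_b k" using stair_gap_a[of _ k] by (force simp: lessThan_Suc)
    then show "x' \<le> y \<and> y < x' + d" using * stair_bounds[of k] by auto
  qed (use lt in auto)
  then have fold_a: "collapses (?I (?A k) (?B (Suc k))) (?I (?A (Suc k)) (?B (Suc k)))"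
    by (simp only: A_eq)
  show ?case
    by (rule rtranclp_trans[OF Suc.IH[OF before] rtranclp_trans[OF fold_b fold_a]])
qed simp

text \<open>
If both sides run out at the same step, the graph has become a matching.
\<close>

lemma staircase_crosspolytope:
  assumes st: "staircase E d a b {i..<n} {j..<n'}"
    and k: "0 < k \<longrightarrow> stair_a (k - 1) < n \<and> stair_b (k - 1) < n'" and stop: "n \<le> stair_a k" "n' \<le> stair_b k"
  shows "\<exists>l. inj_on l ({..<k} \<times> UNIV) \<and>
    collapses (independence_complex (a ` {i..<n} \<union> b ` {j..<n'}) E) ((`) l ` crosspolytope k)"
proof -
  define l where "l = (\<lambda>(p, s). if s then a (stair_a p) else b (stair_b p))"
  note range = stair_in_range[OF k]
  have inj_ab: "inj_on a {i..<n}" "inj_on b {j..<n'}" using st by (simp_all add: staircase_def)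
  have inj_a: "a (stair_a p) = a (stair_a q) \<longleftrightarrow> p = q" if "p < k" "q < k" for p q
  proof -
    have "a (stair_a p) = a (stair_a q) \<longleftrightarrow> stair_a p = stair_a q"
      using range[OF that(1)] range[OF that(2)] by (intro inj_on_eq_iff[OF inj_ab(1)]) auto
    then show ?thesis using strict_mono_eq[OF strict_mono_stair(1)] by simp
  qed
  have inj_b: "b (stair_b p) = b (stair_b q) \<longleftrightarrow> p = q" if "p < k" "q < k" for p q
  proof -
    have "b (stair_b p) = b (stair_b q) \<longleftrightarrow> stair_b p = stair_b q"
      using range[OF that(1)] range[OF that(2)] by (intro inj_on_eq_iff[OF inj_ab(2)]) auto
    then show ?thesis using strict_mono_eq[OF strict_mono_stair(2)] by simp
  qed
  have disj: "a (stair_a p) \<noteq> b (stair_b q)" if "p < k" "q < k" for p q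
  proof -
    have "a (stair_a p) \<in> a ` {i..<n}" "b (stair_b q) \<in> b ` {j..<n'}"
      using range[OF that(1)] range[OF that(2)] by auto
    then show ?thesis using st unfolding staircase_def by fastforce
  qed
  have inj: "inj_on l ({..<k} \<times> UNIV)"
    using inj_a inj_b disj disj[symmetric] by (auto simp: inj_on_def l_def)
  have edge: "{l (p, s), l (q, s')} \<in> E \<longleftrightarrow> p = q \<and> s \<noteq> s'" if "p < k" "q < k" for p q s s'
    using staircase_edge[OF st] range[OF that(1)] range[OF that(2)]
      stair_adjacent_iff[of p q] stair_adjacent_iff[of q p]
    by (cases s; cases s') (auto simp: l_def)
  let ?V = "a ` stair_a ` {..<k} \<union> b ` stair_b ` {..<k}"
  have V: "?V = l ` ({..<k} \<times> UNIV)"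
    by (force simp: l_def UNIV_bool)
  have "independence_complex ?V E = (`) l ` crosspolytope k"
  proof (intro equalityI subsetI)
    fix S assume S: "S \<in> independence_complex ?V E"
    then obtain T where T: "T \<subseteq> {..<k} \<times> UNIV" "S = l ` T"
      unfolding independence_complex_def V by (auto simp: subset_image_iff)
    have "(p, True) \<notin> T \<or> (p, False) \<notin> T" for p
    proof (rule ccontr)
      assume "\<not> ((p, True) \<notin> T \<or> (p, False) \<notin> T)"
      then have p: "l (p, True) \<in> S" "l (p, False) \<in> S" "p < k" using T by auto
      then have "{l (p, True), l (p, False)} \<notin> E" using S by (auto simp: independence_complex_def)
      then show False using edge[OF p(3) p(3)] by simp
    qed
    then show "S \<in> (`) l ` crosspolytope k" using T by (auto simp: crosspolytope_def)
  next
    fix S assume "S \<in> (`) l ` crosspolytope k"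
    then obtain T where T: "T \<in> crosspolytope k" "S = l ` T" by blast
    have TX: "T \<subseteq> {..<k} \<times> UNIV" using T(1) by (simp add: crosspolytope_def)
    have "{u, v} \<notin> E" if uv: "u \<in> S" "v \<in> S" for u v
    proof -
      obtain p s q s' where *: "(p, s) \<in> T" "(q, s') \<in> T" "u = l (p, s)" "v = l (q, s')"
        using uv T(2) by force
      then have "p < k" "q < k" using TX by auto
      moreover have "\<not> (p = q \<and> s \<noteq> s')"
        using * T(1) by (cases s; cases s') (auto simp: crosspolytope_def)
      ultimately show ?thesis using edge * by simp
    qed
    moreover have "S \<subseteq> ?V" "finite S"
      using T(2) TX V finite_subset[OF TX] by auto
    ultimately show "S \<in> independence_complex ?V E" by (simp add: independence_complex_def)
  qed
  then show ?thesis
    using staircase_peel[OF st k] inj stop by (intro exI[of _ l]) (simp add: atLeastLessThan_empty)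
qed

text \<open>
If the second side runs out first, all neighbours of \<open>a (stair_a k)\<close> are gone.
\<close>

lemma staircase_collapsible_a:
  assumes st: "staircase E d a b {i..<n} {j..<n'}"
    and k: "0 < k \<longrightarrow> stair_a (k - 1) < n \<and> stair_b (k - 1) < n'" and stop: "stair_a k < n" "n' \<le> stair_b k"
  shows "collapsible (independence_complex (a ` {i..<n} \<union> b ` {j..<n'}) E)"
proof -
  note range = stair_in_range[OF k]
  let ?V = "a ` (stair_a ` {..<k} \<union> {stair_a k..<n}) \<union> b ` (stair_b ` {..<k} \<union> {stair_b k..<n'})"
  have "collapsible (independence_complex ?V E)"
  proof (rule isolated_vertex_collapsible[where u = "a (stair_a k)"])
    have X: "stair_a k \<in> {i..<n}" using stop stair_mono(1)[of 0 k] by simp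
    fix v assume "v \<in> ?V"
    then consider x where "v = a x" "x \<in> {i..<n}" | l where "v = b (stair_b l)" "l < k"
      using stop range stair_mono(1)[of 0 k] by auto
    then show "{a (stair_a k), v} \<notin> E"
    proof cases
      case 1
      then show ?thesis using staircase_edge(3)[OF st X] by blast
    next
      case 2
      then show ?thesis
        using staircase_edge(1)[OF st X, of "stair_b l"] range[OF 2(2)] stair_gap_a[OF 2(2)] by auto
    qed
  qed (use stop in auto)
  then show ?thesis using staircase_peel[OF st k] collapsible_trans by blast
qed

lemma staircase_collapsible_b:
  assumes st: "staircase E d a b {i..<n} {j..<n'}"
    and k: "0 < k \<longrightarrow> stair_a (k - 1) < n \<and> stair_b (k - 1) < n'" and stop: "n \<le> stair_a k" "stair_b k < n'"
  shows "collapsible (independence_complex (a ` {i..<n} \<union> b ` {j..<n'}) E)"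
proof -
  note range = stair_in_range[OF k]
  let ?V = "a ` (stair_a ` {..<k} \<union> {stair_a k..<n}) \<union> b ` (stair_b ` {..<k} \<union> {stair_b k..<n'})"
  have "collapsible (independence_complex ?V E)"
  proof (rule isolated_vertex_collapsible[where u = "b (stair_b k)"])
    have Y: "stair_b k \<in> {j..<n'}" using stop stair_mono(2)[of 0 k] by simp
    fix v assume "v \<in> ?V"
    then consider y where "v = b y" "y \<in> {j..<n'}" | l where "v = a (stair_a l)" "l < k"
      using stop range stair_mono(2)[of 0 k] by auto
    then show "{b (stair_b k), v} \<notin> E"
    proof cases
      case 1
      then show ?thesis using staircase_edge(4)[OF st Y] by blast
    next
      case 2
      then show ?thesis
        using staircase_edge(2)[OF st _ Y, of "stair_a l"] range[OF 2(2)] stair_gap_b[OF 2(2)] by auto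
    qed
  qed (use stop in auto)
  then show ?thesis using staircase_peel[OF st k] collapsible_trans by blast
qed

end

section \<open>The cyclic graph\<close>

text \<open>
The cyclic graph with some additional edges among the vertices \<open>A\<close>. They serve to separate the
cones in the case of several spheres.
\<close>

definition joined :: "nat \<Rightarrow> nat \<Rightarrow> (nat \<Rightarrow> nat \<Rightarrow> bool) \<Rightarrow> vert set set" where
  "joined m d Q = G_edges m d \<union> {{A (Suc p), A (Suc q)} | p q. p \<noteq> q \<and> Q p q}"

text \<open>
Indices start from \<open>0\<close>, and those of the vertices \<open>B\<close> are read modulo \<open>m\<close>. Thus any interval of \<open>m\<close>
consecutive numbers can serve as index set for the latter, which allows one to cut the circle open at
any place.
\<close>

definition a_vert :: "nat \<Rightarrow> vert" where
  "a_vert x = A (Suc x)"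

definition b_vert :: "nat \<Rightarrow> nat \<Rightarrow> vert" where
  "b_vert m y = B (Suc (y mod m))"

lemma a_vert_eq_iff: "a_vert x = a_vert x' \<longleftrightarrow> x = x'"
  by (simp add: a_vert_def)

lemma a_neq_b: "a_vert x \<noteq> b_vert m y"
  by (simp add: a_vert_def b_vert_def)

lemma joined_none: "joined m d (\<lambda>_ _. False) = G_edges m d"
  by (simp add: joined_def)

lemma joined_ab:
  assumes "x < m"
  shows "{a_vert x, b_vert m y} \<in> joined m d Q \<longleftrightarrow> (\<exists>k<d. (x + k) mod m = y mod m)"
proof -
  have "{a_vert x, b_vert m y} \<in> joined m d Q \<longleftrightarrow> b_vert m y \<in> G_nbhd m d (Suc x)"
    using assms by (auto simp: joined_def G_edges_def G_nbhd_def a_vert_def b_vert_def doubleton_eq_iff)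
  also have "\<dots> \<longleftrightarrow> (\<exists>k<d. (x + k) mod m = y mod m)"
    by (simp add: G_nbhd_def b_vert_def cyc_index_def eq_commute[of "y mod m"]) blast
  finally show ?thesis .
qed

lemma joined_aa: "{a_vert p, a_vert q} \<in> joined m d Q \<longleftrightarrow> p \<noteq> q \<and> (Q p q \<or> Q q p)"
  by (auto simp: joined_def G_edges_def G_nbhd_def a_vert_def doubleton_eq_iff)

lemma joined_bb: "{b_vert m y, b_vert m y'} \<notin> joined m d Q"
  by (auto simp: joined_def G_edges_def b_vert_def doubleton_eq_iff)

lemma mod_add_left_cancel_less:
  fixes m x u v :: nat
  assumes "(x + u) mod m = (x + v) mod m" "u < m" "v < m"
  shows "u = v"
proof -
  have "v = u" if "(x + u) mod m = (x + v) mod m" "u \<le> v" "v < m" for u v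
  proof -
    have "m dvd (x + v) - (x + u)"
      using that by (subst mod_eq_dvd_iff_nat[symmetric]) auto
    then show ?thesis using that(2,3) by (auto dest: dvd_imp_le)
  qed
  then show ?thesis using assms by (metis nat_le_linear)
qed

text \<open>
As \<open>y < x + m\<close>, an edge that runs around the circle would need \<open>y + m < x + d\<close>, which is impossible for \<open>x = r \<le> y\<close>,
and for \<open>r + d \<le> y\<close> because \<open>x < m\<close>.
\<close>

lemma joined_ab_window:
  assumes "d \<le> m" "r \<le> x" "x < m" "r \<le> y" "y < m + r" and "x = r \<or> r + d \<le> y"
  shows "{a_vert x, b_vert m y} \<in> joined m d Q \<longleftrightarrow> x \<le> y \<and> y < x + d"
proof
  assume "{a_vert x, b_vert m y} \<in> joined m d Q"
  then obtain k where k: "k < d" "(x + k) mod m = y mod m" using joined_ab[OF assms(3)] by blast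
  show "x \<le> y \<and> y < x + d"
  proof (cases "x \<le> y")
    case True
    then have "k = y - x"
      using k assms by (intro mod_add_left_cancel_less[of x k m "y - x"]) auto
    then show ?thesis using k True by auto
  next
    case False
    then have "(x + k) mod m = (x + (y + m - x)) mod m" using k assms by simp
    then have "k = y + m - x"
      using k False assms by (intro mod_add_left_cancel_less[of x k m]) auto
    then show ?thesis using k False assms by auto
  qed
next
  assume "x \<le> y \<and> y < x + d"
  then have "y - x < d" "x + (y - x) = y" by auto
  then have "\<exists>k<d. (x + k) mod m = y mod m" by (intro exI[of _ "y - x"]) simp
  then show "{a_vert x, b_vert m y} \<in> joined m d Q"
    using joined_ab[OF assms(3)] by blast
qed

lemma A_window: "A ` {1..m} = a_vert ` {..<m}"
proof -
  have "{1..m} = Suc ` {..<m}" by (simp add: image_Suc_lessThan)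
  then show ?thesis by (simp add: a_vert_def image_image)
qed

lemma B_window:
  assumes "0 < m"
  shows "B ` {1..m} = b_vert m ` {r..<m + r}"
proof (induction r)
  case 0
  have "b_vert m ` {0..<m} = B ` Suc ` {0..<m}"
    unfolding image_image by (intro image_cong) (auto simp: b_vert_def)
  then show ?case by (simp add: image_Suc_atLeastLessThan atLeastLessThanSuc_atLeastAtMost)
next
  case (Suc r)
  have "{r..<m + r} = insert r {Suc r..<m + r}" "{Suc r..<m + Suc r} = insert (m + r) {Suc r..<m + r}"
    using assms by auto
  moreover have "b_vert m (m + r) = b_vert m r" by (simp add: b_vert_def)
  ultimately show ?case using Suc.IH by simp
qed

lemma inj_b_window: "inj_on (b_vert m) {r..<m + r}"
proof (rule inj_onI)
  fix y y' assume y: "y \<in> {r..<m + r}" "y' \<in> {r..<m + r}" "b_vert m y = b_vert m y'"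
  then have "(r + (y - r)) mod m = (r + (y' - r)) mod m" by (simp add: b_vert_def)
  then have "y - r = y' - r" by (rule mod_add_left_cancel_less) (use y in auto)
  then show "y = y'" using y by auto
qed

text \<open>
Away from \<open>a_vert r\<close> and its neighbours there is no wrap-around left.
\<close>

lemma staircase_joined:
  assumes "d \<le> m" "X \<subseteq> {r<..<m}" "Y \<subseteq> {r + d..<m + r}" "\<And>p q. p \<in> X \<Longrightarrow> q \<in> X \<Longrightarrow> \<not> Q p q"
  shows "staircase (joined m d Q) d a_vert (b_vert m) X Y"
  unfolding staircase_def
proof (intro conjI ballI)
  show "{a_vert x, b_vert m y} \<in> joined m d Q \<longleftrightarrow> x \<le> y \<and> y < x + d" if "x \<in> X" "y \<in> Y" for x y
    using that assms by (intro joined_ab_window[of d m r]) auto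
  show "inj_on (b_vert m) Y"
    using inj_b_window[of m r] by (rule inj_on_subset) (use assms(3) in auto)
qed (use assms(4) in \<open>auto simp: joined_aa joined_bb a_neq_b inj_on_def a_vert_eq_iff\<close>)

lemma link_a_vertex:
  assumes "0 < d" "d \<le> m" "P \<subseteq> {..<m}" "r \<in> P"
  shows "link (independence_complex (a_vert ` P \<union> B ` {1..m}) (joined m d Q)) {a_vert r} =
    independence_complex (a_vert ` {x \<in> P. x \<noteq> r \<and> \<not> Q x r \<and> \<not> Q r x} \<union> b_vert m ` {r + d..<m + r})
      (joined m d Q)"
proof -
  have r: "r < m" using assms by auto
  have nbhd: "{b_vert m y, a_vert r} \<in> joined m d Q \<longleftrightarrow> y < r + d" if "y \<in> {r..<m + r}" for y
    using joined_ab_window[of d m r r y Q] assms r that by (auto simp: insert_commute)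
  have "{u \<in> a_vert ` P \<union> b_vert m ` {r..<m + r}. u \<noteq> a_vert r \<and> {u, a_vert r} \<notin> joined m d Q} =
      a_vert ` {x \<in> P. x \<noteq> r \<and> \<not> Q x r \<and> \<not> Q r x} \<union> b_vert m ` {r + d..<m + r}" (is "?L = ?R")
  proof (intro equalityI subsetI)
    fix u assume u: "u \<in> ?L"
    then consider x where "u = a_vert x" "x \<in> P" | y where "u = b_vert m y" "y \<in> {r..<m + r}" by blast
    then show "u \<in> ?R"
    proof cases
      case 1
      then show ?thesis using u by (auto simp: joined_aa a_vert_eq_iff)
    next
      case 2
      then show ?thesis using u nbhd[OF 2(2)] by auto
    qed
  next
    fix u assume u: "u \<in> ?R"
    then consider x where "u = a_vert x" "x \<in> P" "x \<noteq> r" "\<not> Q x r" "\<not> Q r x"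
      | y where "u = b_vert m y" "y \<in> {r + d..<m + r}" by blast
    then show "u \<in> ?L"
    proof cases
      case 1
      then show ?thesis by (auto simp: joined_aa a_vert_eq_iff)
    next
      case 2
      have y: "y \<in> {r..<m + r}" "r + d \<le> y" using 2(2) by auto
      then show ?thesis using nbhd[OF y(1)] a_neq_b[symmetric] 2(1) by auto
    qed
  qed
  moreover have "B ` {1..m} = b_vert m ` {r..<m + r}" using assms by (intro B_window) auto
  moreover have "{a_vert r} \<notin> joined m d Q" using joined_aa[of r r m d Q] by simp
  ultimately show ?thesis
    using assms by (subst link_vertex_independence_complex) auto
qed

text \<open>
Both neighbourhoods together cover the indices from \<open>r\<close> to \<open>s + d - 1\<close> without a gap, since
\<open>s < r + d\<close>.
\<close>

lemma link_a_edge: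
  assumes "0 < d" "d \<le> m" "r < s" "s < d" "\<not> Q r s" "\<not> Q s r"
  shows "link (independence_complex (a_vert ` {..<m} \<union> B ` {1..m}) (joined m d Q)) {a_vert r, a_vert s} =
    independence_complex
      (a_vert ` {x. x < m \<and> x \<noteq> r \<and> x \<noteq> s \<and> \<not> Q x r \<and> \<not> Q r x \<and> \<not> Q x s \<and> \<not> Q s x} \<union>
       b_vert m ` {s + d..<m + r}) (joined m d Q)"
proof -
  have r: "r < m" "s < m" using assms by auto
  have nbhd_r: "{b_vert m y, a_vert r} \<in> joined m d Q \<longleftrightarrow> y < r + d" if "y \<in> {r..<m + r}" for y
    using joined_ab_window[of d m r r y Q] assms r that by (auto simp: insert_commute)
  have nbhd_s: "{b_vert m y, a_vert s} \<in> joined m d Q \<longleftrightarrow> y < s + d" if "y \<in> {r + d..<m + r}" for y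
    using joined_ab_window[of d m r s y Q] assms r that by (auto simp: insert_commute)
  have nbhd: "{b_vert m y, a_vert r} \<notin> joined m d Q \<and> {b_vert m y, a_vert s} \<notin> joined m d Q \<longleftrightarrow>
      s + d \<le> y" if "y \<in> {r..<m + r}" for y
    using nbhd_r[OF that] nbhd_s[of y] that assms by (cases "y < r + d") auto
  have "{u \<in> a_vert ` {..<m} \<union> b_vert m ` {r..<m + r}. u \<noteq> a_vert r \<and> u \<noteq> a_vert s \<and>
        {u, a_vert r} \<notin> joined m d Q \<and> {u, a_vert s} \<notin> joined m d Q} =
      a_vert ` {x. x < m \<and> x \<noteq> r \<and> x \<noteq> s \<and> \<not> Q x r \<and> \<not> Q r x \<and> \<not> Q x s \<and> \<not> Q s x} \<union>
      b_vert m ` {s + d..<m + r}" (is "?L = ?R")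
  proof (intro equalityI subsetI)
    fix u assume u: "u \<in> ?L"
    then consider x where "u = a_vert x" "x < m" | y where "u = b_vert m y" "y \<in> {r..<m + r}" by blast
    then show "u \<in> ?R"
    proof cases
      case 1
      then show ?thesis using u by (auto simp: joined_aa a_vert_eq_iff)
    next
      case 2
      then show ?thesis using u nbhd[OF 2(2)] by auto
    qed
  next
    fix u assume u: "u \<in> ?R"
    then consider x where "u = a_vert x" "x < m" "x \<noteq> r" "x \<noteq> s" "\<not> Q x r" "\<not> Q r x" "\<not> Q x s" "\<not> Q s x"
      | y where "u = b_vert m y" "y \<in> {s + d..<m + r}" by blast
    then show "u \<in> ?L"
    proof cases
      case 1
      then show ?thesis by (auto simp: joined_aa a_vert_eq_iff)
    next
      case 2
      have y: "y \<in> {r..<m + r}" "s + d \<le> y" using 2(2) assms by auto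
      then show ?thesis using nbhd[OF y(1)] a_neq_b[symmetric] 2(1) by auto
    qed
  qed
  moreover have "B ` {1..m} = b_vert m ` {r..<m + r}" using assms by (intro B_window) auto
  moreover have "{a_vert r} \<notin> joined m d Q" "{a_vert s} \<notin> joined m d Q"
    using joined_aa[of r r m d Q] joined_aa[of s s m d Q] by auto
  moreover have "{a_vert r, a_vert s} \<notin> joined m d Q" using assms by (simp add: joined_aa)
  ultimately show ?thesis
    using r by (subst link_edge_independence_complex) auto
qed

text \<open>
The vertices removed are precisely the neighbours of \<open>b_vert m (d - 1)\<close>, which makes it a cone point.
\<close>

lemma collapsible_without_first_d:
  assumes "0 < d" "d \<le> m"
  shows "collapsible (independence_complex (a_vert ` {d..<m} \<union> B ` {1..m}) (joined m d Q))"
proof (rule isolated_vertex_collapsible[where u = "b_vert m (d - 1)"])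
  have B: "B ` {1..m} = b_vert m ` {0..<m}" using B_window[of m 0] assms by simp
  show "b_vert m (d - 1) \<in> a_vert ` {d..<m} \<union> B ` {1..m}" unfolding B using assms by auto
  fix v assume "v \<in> a_vert ` {d..<m} \<union> B ` {1..m}"
  then consider x where "v = a_vert x" "d \<le> x" "x < m" | y where "v = b_vert m y" unfolding B by auto
  then show "{b_vert m (d - 1), v} \<notin> joined m d Q"
  proof cases
    case 1
    have "(x + k) mod m \<noteq> (d - 1) mod m" if "k < d" for k
      using 1 that assms by (cases "x + k < m") (auto simp: le_mod_geq)
    then show ?thesis using joined_ab[OF 1(3), of "d - 1" d Q] 1(1) by (auto simp: insert_commute)
  qed (simp add: joined_bb)
qed auto

context
  fixes m d t \<alpha> :: nat
  assumes d: "0 < d" "d \<le> m" and m: "m = t * (d + 1) + \<alpha>" and \<alpha>: "\<alpha> \<le> d"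
begin

text \<open>
The next five lemmas determine which side of a staircase runs out first. Two steps advance both indices by
\<open>d + 1\<close>, so the decision falls at one of the steps \<open>2t - 2\<close>, \<open>2t - 1\<close> and \<open>2t\<close>. In the first three the graph is
the link of \<open>a\<^sub>r\<close> after deletion of \<open>a\<^sub>0, \<dots>, a\<^bsub>r-1\<^esub>\<close>. At step \<open>2t\<close> the corner is at
\<open>t * (d + 1) + r + 1\<close> on the first side, which equals \<open>m\<close> for \<open>r = \<alpha> - 1\<close>, and at
\<open>t * (d + 1) + r + d \<ge> m + r\<close> on the second.
\<close>

lemma staircase_sphere:
  assumes "0 < \<alpha>" "r = \<alpha> - 1" and st: "staircase E d a b {r + 1..<m} {r + d..<m + r}"
  shows "\<exists>l. inj_on l ({..<2 * t} \<times> UNIV) \<and>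
    collapses (independence_complex (a ` {r + 1..<m} \<union> b ` {r + d..<m + r}) E) ((`) l ` crosspolytope (2 * t))"
proof (rule staircase_crosspolytope[OF _ _ st])
  show "0 < 2 * t \<longrightarrow> fst (stair d (r + 1, r + d) (2 * t - 1)) < m \<and>
      snd (stair d (r + 1, r + d) (2 * t - 1)) < m + r"
  proof (cases t)
    case (Suc t')
    then have "2 * t - 1 = Suc (2 * t')" by simp
    then show ?thesis using assms \<alpha> m Suc by (simp only: stair_odd) simp
  qed simp
qed (use assms d \<alpha> m in \<open>simp_all only: stair_even\<close>, auto)

text \<open>
For a smaller \<open>r\<close> the first side survives step \<open>2t\<close>.
\<close>

lemma staircase_small_offset:
  assumes "r + 1 < \<alpha>" and st: "staircase E d a b {r + 1..<m} {r + d..<m + r}"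
  shows "collapsible (independence_complex (a ` {r + 1..<m} \<union> b ` {r + d..<m + r}) E)"
proof (rule staircase_collapsible_a[OF _ _ st, where k = "2 * t"])
  show "0 < 2 * t \<longrightarrow> fst (stair d (r + 1, r + d) (2 * t - 1)) < m \<and>
      snd (stair d (r + 1, r + d) (2 * t - 1)) < m + r"
  proof (cases t)
    case (Suc t')
    then have "2 * t - 1 = Suc (2 * t')" by simp
    then show ?thesis using assms \<alpha> m Suc by (simp only: stair_odd) simp
  qed simp
qed (use assms d \<alpha> m in \<open>simp_all only: stair_even\<close>, auto)

text \<open>
For a larger \<open>r\<close> both corners are at \<open>t * (d + 1) + r\<close> at step \<open>2t - 1\<close>, which is beyond the first side but not the
second.
\<close>

lemma staircase_large_offset:
  assumes "0 < \<alpha>" "\<alpha> \<le> r" "r < d" and st: "staircase E d a b {r + 1..<m} {r + d..<m + r}"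
  shows "collapsible (independence_complex (a ` {r + 1..<m} \<union> b ` {r + d..<m + r}) E)"
proof -
  obtain t' where t: "t = Suc t'" using assms d m by (cases t) auto
  show ?thesis
    by (rule staircase_collapsible_b[OF _ _ st, where k = "Suc (2 * t')"])
      (use assms m t in \<open>simp_all only: stair_odd stair_even diff_Suc_1\<close>, auto)
qed

text \<open>
The link of the edge \<open>{a\<^sub>r, a\<^sub>s}\<close>. Since the neighbours of \<open>a\<^sub>r\<close> are missing as well as those of \<open>a\<^sub>s\<close>, the
second side ends at \<open>m + r\<close> rather than at \<open>m + s\<close>. At step \<open>2t - 2\<close> its corner is at
\<open>m + s - 1 \<ge> m + r\<close>, while the first side still has vertices.
\<close>

lemma staircase_two_offsets:
  assumes "\<alpha> = 0" "r < s" "s < d" and st: "staircase E d a b {s + 1..<m} {s + d..<m + r}"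
  shows "collapsible (independence_complex (a ` {s + 1..<m} \<union> b ` {s + d..<m + r}) E)"
proof -
  obtain t' where t: "t = Suc t'" using assms d m by (cases t) auto
  show ?thesis
  proof (rule staircase_collapsible_a[OF _ _ st, where k = "2 * t'"])
    show "0 < 2 * t' \<longrightarrow> fst (stair d (s + 1, s + d) (2 * t' - 1)) < m \<and>
        snd (stair d (s + 1, s + d) (2 * t' - 1)) < m + r"
    proof (cases t')
      case (Suc t'')
      then have "2 * t' - 1 = Suc (2 * t'')" by simp
      then show ?thesis using assms m t Suc by (simp only: stair_odd) simp
    qed simp
  qed (use assms m t in \<open>simp_all only: stair_even\<close>, auto)
qed

text \<open>
The link of \<open>a\<^sub>r\<close> once \<open>a\<^sub>0, \<dots>, a\<^bsub>d-1\<^esub>\<close> are pairwise adjacent: at step \<open>2t - 1\<close> the corners are at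
\<open>m + r\<close> and \<open>m + d - 1\<close>, beyond both sides.
\<close>

lemma staircase_wedge_summand:
  assumes "\<alpha> = 0" "r < d" and st: "staircase E d a b {d..<m} {r + d..<m + r}"
  shows "\<exists>l. inj_on l ({..<2 * t - 1} \<times> UNIV) \<and>
    collapses (independence_complex (a ` {d..<m} \<union> b ` {r + d..<m + r}) E) ((`) l ` crosspolytope (2 * t - 1))"
proof -
  obtain t' where t: "t = Suc t'" using assms d m by (cases t) auto
  then have k: "2 * t - 1 = Suc (2 * t')" by simp
  show ?thesis unfolding k
    by (rule staircase_crosspolytope[OF _ _ st])
      (use assms m t in \<open>simp_all only: stair_odd stair_even diff_Suc_1\<close>, auto)
qed

text \<open>
All of \<open>a\<^sub>0, \<dots>, a\<^bsub>d-1\<^esub>\<close> except \<open>a\<^bsub>\<alpha>-1\<^esub>\<close> have contractible links when their turn comes. The ones before it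
are deleted to reach the complex \<open>K\<close> in which it is the first; deleting it and then the ones after it
shows that the rest of \<open>K\<close> is collapsible.
\<close>

lemma independence_complex_bouquet_1:
  assumes "0 < \<alpha>"
  shows "\<exists>lab :: nat \<Rightarrow> nat \<times> bool \<Rightarrow> vert. bouquet_labelling 1 (2 * t) lab \<and>
    geometric_realization (independence_complex (G_verts m) (G_edges m d))
      homotopy_equivalent_space geometric_realization (bouquet 1 (2 * t) lab)"
proof -
  define E where "E = joined m d (\<lambda>_ _. False)"
  define V where "V r = a_vert ` {r..<m} \<union> B ` {1..m}" for r
  define L where "L r = independence_complex (a_vert ` {r + 1..<m} \<union> b_vert m ` {r + d..<m + r}) E" for r
  have link: "link (independence_complex (V r) E) {a_vert r} = L r" if "r < m" for r
  proof -
    have "link (independence_complex (V r) E) {a_vert r} = independence_complex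
        (a_vert ` {x \<in> {r..<m}. x \<noteq> r \<and> \<not> False \<and> \<not> False} \<union> b_vert m ` {r + d..<m + r}) E"
      unfolding V_def E_def using that by (intro link_a_vertex[OF d]) auto
    moreover have "{x \<in> {r..<m}. x \<noteq> r \<and> \<not> False \<and> \<not> False} = {r + 1..<m}" by auto
    ultimately show ?thesis by (simp only: L_def)
  qed
  have st: "staircase E d a_vert (b_vert m) {r + 1..<m} {r + d..<m + r}" for r
    unfolding E_def by (rule staircase_joined[of d m _ r]) (use d in auto)
  have V_Suc: "V r - {a_vert r} = V (Suc r)" if "r < m" for r
  proof -
    have "{r..<m} = insert r {Suc r..<m}" using that by auto
    moreover have "a_vert r \<notin> B ` {1..m}" by (auto simp: a_vert_def)
    ultimately show ?thesis by (auto simp: V_def a_vert_eq_iff)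
  qed
  have delete: "collapses (independence_complex (V p) E) (independence_complex (V q) E)"
    if "p \<le> q" "q \<le> m" "\<And>r. p \<le> r \<Longrightarrow> r < q \<Longrightarrow> collapsible (L r)" for p q
    using that
  proof (induction q rule: dec_induct)
    case (step q)
    have "collapses (independence_complex (V q) E) (delete_star (independence_complex (V q) E) {a_vert q})"
      using link[of q] step by (intro collapse_collapsible_link) auto
    then have "collapses (independence_complex (V q) E) (independence_complex (V (Suc q)) E)"
      using V_Suc[of q] step.prems by (simp add: delete_vertex_independence_complex)
    moreover have "collapses (independence_complex (V p) E) (independence_complex (V q) E)"
      using step by auto
    ultimately show ?case by (rule rtranclp_trans[rotated])
  qed simp
  have \<alpha>m: "\<alpha> \<le> m" "\<alpha> - 1 < m" using \<alpha> d assms by auto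
  let ?r = "\<alpha> - 1"
  let ?K = "independence_complex (V ?r) E"
  have "G_verts m = V 0" "G_edges m d = E"
    by (simp_all add: G_verts_def V_def A_window[symmetric] atLeast0LessThan E_def joined_none)
  moreover have "collapses (independence_complex (V 0) E) ?K"
    using staircase_small_offset[OF _ st] \<alpha>m by (intro delete) (auto simp: L_def)
  ultimately have K: "geometric_realization (independence_complex (G_verts m) (G_edges m d))
      homotopy_equivalent_space geometric_realization ?K"
    using collapses_homotopy_equivalent subset_closed_independence_complex by metis
  have base: "collapsible (independence_complex (V \<alpha>) E)"
  proof (rule collapsible_trans)
    show "collapses (independence_complex (V \<alpha>) E) (independence_complex (V d) E)"
      using staircase_large_offset[OF assms _ _ st] \<alpha> d by (intro delete) (auto simp: L_def)
    show "collapsible (independence_complex (V d) E)"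
      unfolding V_def E_def using d by (rule collapsible_without_first_d)
  qed
  obtain l where l: "inj_on l ({..<2 * t} \<times> UNIV)" "collapses (L ?r) ((`) l ` crosspolytope (2 * t))"
    using staircase_sphere[OF assms refl st] unfolding L_def by blast
  have "\<exists>lab :: nat \<Rightarrow> nat \<times> bool \<Rightarrow> vert. bouquet_labelling 1 (2 * t) lab \<and>
      geometric_realization ?K homotopy_equivalent_space geometric_realization (bouquet 1 (2 * t) lab)"
  proof (rule bouquet_of_cones[where v = "\<lambda>_. a_vert ?r" and l = "\<lambda>_. l"])
    have "range A \<subseteq> (UNIV :: vert set)" "infinite (range A)"
      by (auto simp: finite_image_iff inj_on_def)
    then show "infinite (UNIV :: vert set)" using finite_subset by blast
    show "finite (\<Union>?K)" by (rule finite_independence_complex) (simp add: V_def)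
    have "{\<sigma> \<in> ?K. \<sigma> \<inter> (\<lambda>_. a_vert ?r) ` {1..1::nat} = {}} = independence_complex (V ?r - {a_vert ?r}) E"
      by (auto simp: independence_complex_def)
    then show "collapsible {\<sigma> \<in> ?K. \<sigma> \<inter> (\<lambda>_. a_vert ?r) ` {1..1::nat} = {}}"
      using base V_Suc[OF \<alpha>m(2)] assms by simp
  qed (use l link[OF \<alpha>m(2)] subset_closed_independence_complex in auto)
  then show ?thesis using K homotopy_eqv_trans by blast
qed

text \<open>
The edges \<open>{a\<^sub>r, a\<^sub>s}\<close> with \<open>r < s < d\<close> are added in lexicographic order; \<open>Q r s\<close> describes those that precede
the pair \<open>(r, s)\<close>. With this order, the vertices \<open>a\<^sub>x\<close> with \<open>x < s\<close> are adjacent to \<open>a\<^sub>r\<close> when the turn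
of \<open>(r, s)\<close> comes, so they are absent from the link of the edge, and no added edge remains in it.
\<close>

lemma independence_complex_bouquet_d:
  assumes \<alpha>0: "\<alpha> = 0"
  shows "\<exists>lab :: nat \<Rightarrow> nat \<times> bool \<Rightarrow> vert. bouquet_labelling d (2 * t - 1) lab \<and>
    geometric_realization (independence_complex (G_verts m) (G_edges m d))
      homotopy_equivalent_space geometric_realization (bouquet d (2 * t - 1) lab)"
proof -
  define V where "V = a_vert ` {..<m} \<union> B ` {1..m}"
  define Q where "Q r s p q \<longleftrightarrow> p < q \<and> q < d \<and> (p < r \<or> p = r \<and> q < s)" for r s p q :: nat
  define K where "K r s = independence_complex V (joined m d (Q r s))" for r s
  have add_edge: "collapses (K r s) (K r (Suc s))" if rs: "r < s" "s < d" for r s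
  proof -
    have notQ: "\<not> Q r s r s" "\<not> Q r s s r" using rs by (auto simp: Q_def)
    have "{x. x < m \<and> x \<noteq> r \<and> x \<noteq> s \<and> \<not> Q r s x r \<and> \<not> Q r s r x \<and> \<not> Q r s x s \<and> \<not> Q r s s x} = {s + 1..<m}"
      using rs d by (auto simp: Q_def)
    then have "link (K r s) {a_vert r, a_vert s} =
        independence_complex (a_vert ` {s + 1..<m} \<union> b_vert m ` {s + d..<m + r}) (joined m d (Q r s))"
      unfolding K_def V_def using link_a_edge[OF d rs notQ] by simp
    moreover have st: "staircase (joined m d (Q r s)) d a_vert (b_vert m) {s + 1..<m} {s + d..<m + r}"
      by (rule staircase_joined[of d m _ r]) (use d rs in \<open>auto simp: Q_def\<close>)
    ultimately have "collapsible (link (K r s) {a_vert r, a_vert s})"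
      using staircase_two_offsets[OF \<alpha>0 rs st] by (simp only:)
    then have "collapses (K r s) (delete_star (K r s) {a_vert r, a_vert s})"
      by (rule collapse_collapsible_link) auto
    moreover have "delete_star (K r s) {a_vert r, a_vert s} = K r (Suc s)"
    proof -
      have "insert {a_vert r, a_vert s} (joined m d (Q r s)) = joined m d (Q r (Suc s))"
        using rs by (auto simp: joined_def Q_def a_vert_def less_Suc_eq)
      then show ?thesis unfolding K_def
        using rs by (subst delete_edge_independence_complex) (auto simp: a_vert_eq_iff)
    qed
    ultimately show ?thesis by simp
  qed
  have row: "collapses (K r (Suc r)) (K r s)" if "Suc r \<le> s" "s \<le> d" for r s
    using that
  proof (induction s rule: dec_induct)
    case (step s)
    then show ?case using add_edge[of r s] by (meson Suc_leD Suc_le_eq rtranclp_trans)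
  qed simp
  have "collapses (K 0 1) (K r (Suc r))" if "r < d" for r
    using that
  proof (induction r)
    case (Suc r)
    have "Q r d = Q (Suc r) (Suc (Suc r))"
      using Suc.prems by (intro ext) (auto simp: Q_def less_Suc_eq)
    then have "K r d = K (Suc r) (Suc (Suc r))" by (simp add: K_def)
    then show ?case using Suc.IH Suc.prems row[of r d] by (metis Suc_leD Suc_le_eq order_refl rtranclp_trans)
  qed simp
  from this[of "d - 1"] have "collapses (K 0 1) (K (d - 1) d)" using d by simp
  moreover have "Q 0 1 = (\<lambda>_ _. False)" by (intro ext) (auto simp: Q_def)
  then have "K 0 1 = independence_complex (G_verts m) (G_edges m d)"
    by (simp add: K_def joined_none G_verts_def V_def A_window[symmetric])
  ultimately have hom: "geometric_realization (independence_complex (G_verts m) (G_edges m d))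
      homotopy_equivalent_space geometric_realization (K (d - 1) d)"
    using collapses_homotopy_equivalent subset_closed_independence_complex by metis
  define C where "C p q \<longleftrightarrow> p < q \<and> q < d" for p q
  define E where "E = joined m d C"
  have "Q (d - 1) d = C" by (intro ext) (auto simp: Q_def C_def)
  then have K: "K (d - 1) d = independence_complex V E" by (simp add: K_def E_def)
  have "\<exists>l. inj_on l ({..<2 * t - 1} \<times> UNIV) \<and>
      collapses (link (independence_complex V E) {a_vert r}) ((`) l ` crosspolytope (2 * t - 1))"
    if r: "r < d" for r
  proof -
    have "link (independence_complex V E) {a_vert r} = independence_complex
        (a_vert ` {x \<in> {..<m}. x \<noteq> r \<and> \<not> C x r \<and> \<not> C r x} \<union> b_vert m ` {r + d..<m + r}) E"
      unfolding V_def E_def using r d by (intro link_a_vertex[OF d]) auto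
    moreover have "{x \<in> {..<m}. x \<noteq> r \<and> \<not> C x r \<and> \<not> C r x} = {d..<m}"
      using r d by (auto simp: C_def)
    moreover have st: "staircase E d a_vert (b_vert m) {d..<m} {r + d..<m + r}"
      unfolding E_def by (rule staircase_joined[of d m _ r]) (use d r in \<open>auto simp: C_def\<close>)
    ultimately show ?thesis using staircase_wedge_summand[OF \<alpha>0 r st] by (simp only:)
  qed
  then obtain l where l: "\<And>r. r < d \<Longrightarrow> inj_on (l r) ({..<2 * t - 1} \<times> UNIV)"
    "\<And>r. r < d \<Longrightarrow> collapses (link (independence_complex V E) {a_vert r}) ((`) (l r) ` crosspolytope (2 * t - 1))"
    by metis
  have "\<exists>lab :: nat \<Rightarrow> nat \<times> bool \<Rightarrow> vert. bouquet_labelling d (2 * t - 1) lab \<and>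
      geometric_realization (independence_complex V E)
        homotopy_equivalent_space geometric_realization (bouquet d (2 * t - 1) lab)"
  proof (rule bouquet_of_cones[where v = "\<lambda>r. a_vert (r - 1)" and l = "\<lambda>r. l (r - 1)"])
    have "range A \<subseteq> (UNIV :: vert set)" "infinite (range A)"
      by (auto simp: finite_image_iff inj_on_def)
    then show "infinite (UNIV :: vert set)" using finite_subset by blast
    show "finite (\<Union>(independence_complex V E))" by (rule finite_independence_complex) (simp add: V_def)
    show "r = s" if "r \<in> {1..d}" "s \<in> {1..d}" "\<sigma> \<in> independence_complex V E"
      "a_vert (r - 1) \<in> \<sigma>" "a_vert (s - 1) \<in> \<sigma>" for r s \<sigma>
    proof -
      have "{a_vert (r - 1), a_vert (s - 1)} \<notin> E" using that(3-5) by (auto simp: independence_complex_def)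
      then show ?thesis using that(1,2) unfolding E_def joined_aa C_def by auto
    qed
    have "(\<lambda>r. a_vert (r - 1)) ` {1..d} = a_vert ` {..<d}"
    proof -
      have "{..<d} = (\<lambda>r. r - 1) ` {1..d}" by (force simp: image_iff intro: bexI[of _ "Suc _"])
      then show ?thesis by (simp add: image_image)
    qed
    then have "{\<sigma> \<in> independence_complex V E. \<sigma> \<inter> (\<lambda>r. a_vert (r - 1)) ` {1..d} = {}} =
        independence_complex (V - a_vert ` {..<d}) E"
      by (auto simp: independence_complex_def)
    also have "V - a_vert ` {..<d} = a_vert ` {d..<m} \<union> B ` {1..m}"
    proof -
      have "a_vert ` {..<d} \<inter> B ` {1..m} = {}" by (auto simp: a_vert_def)
      moreover have "a_vert ` {..<m} - a_vert ` {..<d} = a_vert ` {d..<m}"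
      proof -
        have "inj a_vert" by (simp add: inj_def a_vert_eq_iff)
        moreover have "{..<m} - {..<d} = {d..<m}" by auto
        ultimately show ?thesis by (metis image_set_diff)
      qed
      ultimately show ?thesis unfolding V_def by blast
    qed
    finally show "collapsible {\<sigma> \<in> independence_complex V E. \<sigma> \<inter> (\<lambda>r. a_vert (r - 1)) ` {1..d} = {}}"
      using collapsible_without_first_d[OF d] by (simp add: E_def)
  qed (use l d subset_closed_independence_complex in auto)
  then show ?thesis using hom K homotopy_eqv_trans by metis
qed

end

theorem theorem1p2:
  fixes m d t \<alpha> :: nat
  assumes "0 < m" and "0 < d" and "d \<le> m"
    and "m = t * (d + 1) + \<alpha>" and "\<alpha> \<le> d"
  shows "(\<alpha> = 0 \<longrightarrow>
            geometric_realization (independence_complex (G_verts m) (G_edges m d))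
              homotopy_equivalent_space wedge_of_spheres d (2 * t - 1)) \<and>
         (\<alpha> \<noteq> 0 \<longrightarrow>
            geometric_realization (independence_complex (G_verts m) (G_edges m d))
              homotopy_equivalent_space nsphere (2 * t))"
proof (intro conjI impI)
  assume "\<alpha> = 0"
  then obtain lab :: "nat \<Rightarrow> nat \<times> bool \<Rightarrow> vert" where lab: "bouquet_labelling d (2 * t - 1) lab"
    "geometric_realization (independence_complex (G_verts m) (G_edges m d))
       homotopy_equivalent_space geometric_realization (bouquet d (2 * t - 1) lab)"
    using independence_complex_bouquet_d[OF assms(2-5)] by blast
  have "geometric_realization (bouquet d (2 * t - 1) lab)
      homotopy_equivalent_space wedge_of_spheres d (2 * t - 1)"
    using bouquet_homeomorphic_wedge_of_spheres[OF lab(1)] homeomorphic_space_sym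
      homeomorphic_imp_homotopy_equivalent_space by blast
  with lab(2) show "geometric_realization (independence_complex (G_verts m) (G_edges m d))
      homotopy_equivalent_space wedge_of_spheres d (2 * t - 1)"
    by (rule homotopy_eqv_trans)
next
  assume "\<alpha> \<noteq> 0"
  then obtain lab :: "nat \<Rightarrow> nat \<times> bool \<Rightarrow> vert" where lab: "bouquet_labelling 1 (2 * t) lab"
    "geometric_realization (independence_complex (G_verts m) (G_edges m d))
       homotopy_equivalent_space geometric_realization (bouquet 1 (2 * t) lab)"
    using independence_complex_bouquet_1[OF assms(2-5)] by blast
  have "geometric_realization (bouquet 1 (2 * t) lab) homotopy_equivalent_space nsphere (2 * t)"
    using bouquet_homeomorphic_sphere[OF lab(1)] homeomorphic_space_sym
      homeomorphic_imp_homotopy_equivalent_space by blast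
  with lab(2) show "geometric_realization (independence_complex (G_verts m) (G_edges m d))
      homotopy_equivalent_space nsphere (2 * t)"
    by (rule homotopy_eqv_trans)
qed

end
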